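(* Let $G$ be an amenable group generated by a finite set $\Sigma$, and let $\sigma$ be an inner automorphism of $G$ of order two, say $\sigma(x)=gxg^{-1}$. Let $\pi_i:G\to G_i$ ($i\in\mathbb N$) be an infinite family of surjective homomorphisms onto finite groups $G_i$ with pairwise distinct kernels, and let $\sigma_i$ be the automorphism of $G_i$ given by conjugation by $\pi_i(g)$. Then the family of twisted Cayley graphs $\{C(G_i,\pi_i(\Sigma\cup\sigma(\Sigma^{-1})))^{\sigma_i}\}_i$ is a non-expander family, i.e. the nontrivial spectra of the normalized adjacency operators of these graphs are not uniformly bounded away from $1$.
   Context: For a finite group $K$, a multiset $T$ of elements of $K$ and an automorphism $\tau$ of $K$, the twisted Cayley graph $C(K,T)^\tau$ has vertex set $K$ and an edge from $x$ to $\tau(xt)$ for each $t\in T$; it is $|T|$-regular and its normalized adjacency operator is its adjacency operator divided by $|T|$. The nontrivial spectrum is the multiset of eigenvalues with one copy of $1$ removed. "Not uniformly bounded away from $1$" means there is no $c>0$ such that for every $i$ all nontrivial eigenvalues of the $i$-th normalized adjacency operator have real part at most $1-c$. *)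

theory Defs
  imports Complex_Main "HOL-Algebra.Generated_Groups" "HOL-Algebra.Coset"
    "HOL-Combinatorics.Permutations" "HOL-Computational_Algebra.Polynomial"
    "HOL-Library.Multiset"
begin

definition amenable :: "('a, 'm) monoid_scheme \<Rightarrow> bool" where
  "amenable G \<longleftrightarrow> (\<exists>\<mu> :: 'a set \<Rightarrow> real.
      (\<forall>A. A \<subseteq> carrier G \<longrightarrow> \<mu> A \<ge> 0) \<and>
      \<mu> (carrier G) = 1 \<and>
      (\<forall>A B. A \<subseteq> carrier G \<longrightarrow> B \<subseteq> carrier G \<longrightarrow> A \<inter> B = {}
               \<longrightarrow> \<mu> (A \<union> B) = \<mu> A + \<mu> B) \<and>
      (\<forall>g \<in> carrier G. \<forall>A. A \<subseteq> carrier G \<longrightarrow> \<mu> (l_coset G g A) = \<mu> A))"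

definition twisted_cayley_norm_adj ::
    "('b, 'n) monoid_scheme \<Rightarrow> 'b multiset \<Rightarrow> ('b \<Rightarrow> 'b) \<Rightarrow> 'b \<Rightarrow> 'b \<Rightarrow> complex" where
  "twisted_cayley_norm_adj K T \<tau> x y =
     of_nat (size (filter_mset (\<lambda>t. \<tau> (x \<otimes>\<^bsub>K\<^esub> t) = y) T)) / of_nat (size T)"

text \<open>Characteristic polynomial det(X*I - A) of an operator A on the finite set V
  (Leibniz formula; basis-free).\<close>
definition char_poly_on :: "'b set \<Rightarrow> ('b \<Rightarrow> 'b \<Rightarrow> complex) \<Rightarrow> complex poly" where
  "char_poly_on V A =
     (\<Sum>p \<in> {p. p permutes V}. of_int (sign p) *
        (\<Prod>x\<in>V. [: - A x (p x), (if p x = x then 1 else 0) :]))"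

definition spectrum_on :: "'b set \<Rightarrow> ('b \<Rightarrow> 'b \<Rightarrow> complex) \<Rightarrow> complex multiset" where
  "spectrum_on V A = proots (char_poly_on V A)"

definition nontrivial_spectrum_on :: "'b set \<Rightarrow> ('b \<Rightarrow> 'b \<Rightarrow> complex) \<Rightarrow> complex multiset" where
  "nontrivial_spectrum_on V A = spectrum_on V A - {#1#}"

end

theory Submission
  imports Defs "Jordan_Normal_Form.Char_Poly"
begin

text \<open>The set \<open>\<Sigma> \<union> \<sigma>(\<Sigma>\<^sup>-\<^sup>1)\<close> is stable under \<open>t \<mapsto> \<sigma>(t\<^sup>-\<^sup>1)\<close>, so the twisted adjacency
  operator is symmetric, and a spectral gap \<open>c\<close> bounds its quadratic form by \<open>1 - c\<close> on the
  orthogonal complement of the constants. Since \<open>\<sigma>\<close> is an involution, \<open>g\<^sup>2\<close> is central: if a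
  function \<open>f\<close> on a finite quotient is almost invariant under right translations by \<open>t g\<close> and
  \<open>t g\<^sup>-\<^sup>1\<close>, then \<open>y \<mapsto> f y + f (g y)\<close> is almost invariant under \<open>y \<mapsto> \<sigma>(y t)\<close>. Taking for \<open>f\<close>
  the push-forward of a Foelner set of \<open>G\<close>, the square root of this sum is a test function with
  quadratic form close to its squared norm. As the kernels are pairwise distinct and \<open>G\<close> is
  finitely generated, the quotients are unboundedly large, so that its component along the constants
  becomes negligible.\<close>

section \<open>Spectra and quadratic forms\<close>

text \<open>Conjugation by the enumeration \<open>e\<close> carries the permutations of
  \<open>{0..<n}\<close> to those of \<open>V\<close> and preserves signs, so the two Leibniz sums
  agree term by term. This makes determinant calculus available for
  \<open>char_poly_on\<close>.\<close>

lemma char_poly_on_eq_char_poly: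
  assumes e: "bij_betw e {0..<n} V"
  shows "char_poly_on V A = char_poly (mat n n (\<lambda>(i, j). A (e i) (e j)))"
proof -
  have perm: "bij_betw (map_permutation {0..<n} e) {p. p permutes {0..<n}} {p. p permutes V}"
  proof (rule bij_betwI[where g = "map_permutation V (inv_into {0..<n} e)"])
    have e': "bij_betw (inv_into {0..<n} e) V {0..<n}"
      by (rule bij_betw_inv_into[OF e])
    show "map_permutation {0..<n} e \<in> {p. p permutes {0..<n}} \<rightarrow> {p. p permutes V}"
      using map_permutation_permutes[OF e] by auto
    show "map_permutation V (inv_into {0..<n} e) \<in> {p. p permutes V} \<rightarrow> {p. p permutes {0..<n}}"
      using map_permutation_permutes[OF e'] by auto
    show "map_permutation V (inv_into {0..<n} e) (map_permutation {0..<n} e p) = p"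
      if "p \<in> {p. p permutes {0..<n}}" for p
      using that e e' by (intro map_permutation_compose_inv) (auto simp: bij_betw_def)
    show "map_permutation {0..<n} e (map_permutation V (inv_into {0..<n} e) p) = p"
      if "p \<in> {p. p permutes V}" for p
      using that e e'
      by (intro map_permutation_compose_inv) (auto simp: bij_betw_def f_inv_into_f)
  qed
  let ?M = "mat n n (\<lambda>(i, j). A (e i) (e j))"
  have inj: "inj_on e {0..<n}" using e by (simp add: bij_betw_def)
  have "char_poly_on V A = (\<Sum>p \<in> {p. p permutes {0..<n}}. of_int (sign (map_permutation {0..<n} e p)) *
        (\<Prod>x\<in>V. [: - A x (map_permutation {0..<n} e p x),
           (if map_permutation {0..<n} e p x = x then 1 else 0) :]))"
    unfolding char_poly_on_def by (rule sum.reindex_bij_betw[OF perm, symmetric])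
  also have "\<dots> = (\<Sum>p \<in> {p. p permutes {0..<n}}. of_int (sign p) *
        (\<Prod>i = 0..<n. char_poly_matrix ?M $$ (i, p i)))"
  proof (rule sum.cong[OF refl])
    fix p assume "p \<in> {p. p permutes {0..<n}}"
    then have p: "p permutes {0..<n}" by simp
    have "(\<Prod>x\<in>V. [: - A x (map_permutation {0..<n} e p x),
           (if map_permutation {0..<n} e p x = x then 1 else 0) :])
        = (\<Prod>i = 0..<n. [: - A (e i) (map_permutation {0..<n} e p (e i)),
           (if map_permutation {0..<n} e p (e i) = e i then 1 else 0) :])"
      by (rule prod.reindex_bij_betw[OF e, symmetric])
    also have "\<dots> = (\<Prod>i = 0..<n. char_poly_matrix ?M $$ (i, p i))"
    proof (rule prod.cong[OF refl])
      fix i assume i: "i \<in> {0..<n}"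
      then have pi: "p i \<in> {0..<n}" using p by (simp only: permutes_in_image)
      have "e (p i) = e i \<longleftrightarrow> p i = i" using inj i pi by (auto dest: inj_onD)
      then show "[: - A (e i) (map_permutation {0..<n} e p (e i)),
           (if map_permutation {0..<n} e p (e i) = e i then 1 else 0) :]
         = char_poly_matrix ?M $$ (i, p i)"
        using i pi inj by (auto simp: char_poly_matrix_def map_permutation_apply)
    qed
    finally show "of_int (sign (map_permutation {0..<n} e p)) *
        (\<Prod>x\<in>V. [: - A x (map_permutation {0..<n} e p x),
           (if map_permutation {0..<n} e p x = x then 1 else 0) :])
      = of_int (sign p) * (\<Prod>i = 0..<n. char_poly_matrix ?M $$ (i, p i))"
      using sign_map_permutation[OF inj p] by simp
  qed
  also have "\<dots> = char_poly ?M"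
    unfolding char_poly_def by (rule det_def'[symmetric]) simp
  finally show ?thesis .
qed

text \<open>Rank-one case of Sylvester's identity det (1 - U W) = det (1 - W U), with the sign put
  into \<open>?W\<close>. \<open>?N\<close> and \<open>?D\<close> are the two Schur complements of
  the matrix with identity diagonal blocks and off-diagonal blocks \<open>?U\<close>,
  \<open>?W\<close>, and its two block triangular factorizations are compared.\<close>

lemma det_one_plus_rank_one:
  fixes u w :: "nat \<Rightarrow> 'a :: idom"
  shows "det (mat n n (\<lambda>(i, j). (if i = j then 1 else 0) + u i * w j)) = 1 + (\<Sum>i<n. w i * u i)"
proof -
  let ?U = "mat n 1 (\<lambda>(i, j). u i)" and ?W = "mat 1 n (\<lambda>(i, j). - w j)"
  let ?D = "mat 1 1 (\<lambda>_. 1 + (\<Sum>i<n. w i * u i))"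
  let ?N = "mat n n (\<lambda>(i, j). (if i = j then 1 else 0) + u i * w j)"
  have N: "?N \<in> carrier_mat n n" and U: "?U \<in> carrier_mat n 1" and W: "?W \<in> carrier_mat 1 n"
    and D: "?D \<in> carrier_mat 1 1" by auto
  have NUW: "?N + ?U * ?W = 1\<^sub>m n"
    by (rule eq_matI) (auto simp: scalar_prod_def)
  have WUD: "?W * ?U + ?D = 1\<^sub>m 1"
    by (rule eq_matI) (auto simp: scalar_prod_def atLeast0LessThan sum_negf)
  have "four_block_mat (1\<^sub>m n) ?U (0\<^sub>m 1 n) (1\<^sub>m 1) * four_block_mat ?N (0\<^sub>m n 1) ?W (1\<^sub>m 1)
      = four_block_mat (1\<^sub>m n) ?U ?W (1\<^sub>m 1)"
    by (subst mult_four_block_mat[OF one_carrier_mat U zero_carrier_mat one_carrier_mat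
          N zero_carrier_mat W one_carrier_mat])
      (simp add: NUW left_mult_one_mat[OF N] left_mult_one_mat[OF W] right_mult_one_mat[OF U]
        left_mult_zero_mat[OF N] left_add_zero_mat[OF W] left_add_zero_mat[OF U] del: One_nat_def)
  also have "\<dots> = four_block_mat (1\<^sub>m n) (0\<^sub>m n 1) ?W (1\<^sub>m 1) * four_block_mat (1\<^sub>m n) ?U (0\<^sub>m 1 n) ?D"
    by (subst mult_four_block_mat[OF one_carrier_mat zero_carrier_mat W one_carrier_mat
          one_carrier_mat U zero_carrier_mat D])
      (simp add: WUD left_mult_one_mat[OF D] right_mult_one_mat[OF W] left_mult_one_mat[OF U]
        left_mult_zero_mat[OF D] right_add_zero_mat[OF W] right_add_zero_mat[OF U] del: One_nat_def)
  finally have eq: "four_block_mat (1\<^sub>m n) ?U (0\<^sub>m 1 n) (1\<^sub>m 1) * four_block_mat ?N (0\<^sub>m n 1) ?W (1\<^sub>m 1)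
      = four_block_mat (1\<^sub>m n) (0\<^sub>m n 1) ?W (1\<^sub>m 1) * four_block_mat (1\<^sub>m n) ?U (0\<^sub>m 1 n) ?D" .
  have "det (four_block_mat (1\<^sub>m n) ?U (0\<^sub>m 1 n) (1\<^sub>m 1)) * det (four_block_mat ?N (0\<^sub>m n 1) ?W (1\<^sub>m 1))
      = det (four_block_mat (1\<^sub>m n) (0\<^sub>m n 1) ?W (1\<^sub>m 1)) * det (four_block_mat (1\<^sub>m n) ?U (0\<^sub>m 1 n) ?D)"
    using arg_cong[OF eq, of det]
    by (subst (asm) (1 2) det_mult[of _ "n + 1"]) auto
  then show ?thesis
    by (simp add: det_four_block_mat_lower_left_zero[OF one_carrier_mat U refl one_carrier_mat]
        det_four_block_mat_lower_left_zero[OF one_carrier_mat U refl D]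
        det_four_block_mat_upper_right_zero[OF N refl W one_carrier_mat]
        det_four_block_mat_upper_right_zero[OF one_carrier_mat refl W one_carrier_mat]
        det_single[OF D] del: One_nat_def)
qed

text \<open>Brauer's deflation: a rank-one update along an eigenvector \<open>u\<close> only moves
  the eigenvalue \<open>k\<close> of \<open>u\<close>. For x distinct from \<open>k\<close>, x - B =
  (x - A) (1 - u w^T / (x - k)) because (x - A) u = (x - k) u, and the determinant of the last
  factor is known. Linear factors are cross-multiplied to avoid a division of polynomials.\<close>

lemma char_poly_rank_one_deflation:
  fixes A :: "'a :: field_char_0 mat"
  assumes A: "A \<in> carrier_mat n n"
    and u: "\<And>i. i < n \<Longrightarrow> (\<Sum>j<n. A $$ (i, j) * u j) = k * u i"
  shows "char_poly (A + mat n n (\<lambda>(i, j). u i * w j)) * [:- k, 1:] =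
    char_poly A * [:- (k + (\<Sum>i<n. w i * u i)), 1:]"
proof -
  let ?B = "A + mat n n (\<lambda>(i, j). u i * w j)"
  have B: "?B \<in> carrier_mat n n" using A by simp
  have main: "poly (char_poly ?B) x * (x - k) = poly (char_poly A) x * (x - (k + (\<Sum>i<n. w i * u i)))"
    if "x \<noteq> k" for x
  proof -
    let ?R = "mat n n (\<lambda>(i, j). (if i = j then 1 else 0) + u i * (- w j / (x - k)))"
    have fac: "- char_matrix ?B x = - char_matrix A x * ?R"
    proof (rule eq_matI)
      fix i j assume ij: "i < dim_row (- char_matrix A x * ?R)" "j < dim_col (- char_matrix A x * ?R)"
      then have i: "i < n" and j: "j < n" using A by (auto simp: char_matrix_def)
      define a where "a = (\<lambda>l. (if i = l then x else 0) - A $$ (i, l))"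
      define t where "t = - w j / (x - k)"
      have "(C * ?R) $$ (i, j) = (\<Sum>l<n. C $$ (i, l) * ?R $$ (l, j))"
        if "C \<in> carrier_mat n n" for C
        using i j that by (simp add: scalar_prod_def atLeast0LessThan)
      from this[of "- char_matrix A x"] have "(- char_matrix A x * ?R) $$ (i, j) =
        (\<Sum>l<n. (- char_matrix A x) $$ (i, l) * ?R $$ (l, j))"
        using A by simp
      also have "\<dots> = (\<Sum>l<n. a l * ((if l = j then 1 else 0) + u l * t))"
        using i j A by (intro sum.cong refl) (auto simp: char_matrix_def a_def t_def)
      also have "\<dots> = (\<Sum>l<n. if l = j then a l else 0) + (\<Sum>l<n. a l * u l) * t"
        unfolding sum_distrib_right sum.distrib[symmetric]
        by (intro sum.cong refl) (auto simp: algebra_simps)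
      also have "(\<Sum>l<n. if l = j then a l else 0) = a j"
        using j by simp
      also have "(\<Sum>l<n. a l * u l) = (\<Sum>l<n. if i = l then x * u l else 0) - (\<Sum>l<n. A $$ (i, l) * u l)"
        unfolding sum_subtractf[symmetric]
        by (intro sum.cong refl) (auto simp: a_def algebra_simps)
      also have "\<dots> = (x - k) * u i"
        using i by (simp add: u left_diff_distrib)
      also have "a j + (x - k) * u i * t = a j - u i * w j"
        using that by (simp add: t_def)
      also have "\<dots> = (- char_matrix ?B x) $$ (i, j)"
        using i j A by (simp add: char_matrix_def a_def)
      finally show "(- char_matrix ?B x) $$ (i, j) = (- char_matrix A x * ?R) $$ (i, j)" ..
    qed (use A in \<open>auto simp: char_matrix_def\<close>)
    have "poly (char_poly ?B) x = poly (char_poly A) x * det ?R"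
      unfolding char_poly_matrix[OF A] char_poly_matrix[OF B] fac
      by (rule det_mult) (use A in auto)
    also have "det ?R = 1 - (\<Sum>i<n. w i * u i) / (x - k)"
      unfolding det_one_plus_rank_one by (simp add: sum_divide_distrib sum_negf)
    finally show ?thesis
      using that by (simp add: field_simps)
  qed
  \<comment> \<open>\<open>main\<close> leaves out the point \<open>k\<close>. One more factor
    \<open>[:- k, 1:]\<close> vanishes there, so both sides agree everywhere, and it is cancelled
    afterwards.\<close>
  have "(char_poly ?B * [:- k, 1:]) * [:- k, 1:] = (char_poly A * [:- (k + (\<Sum>i<n. w i * u i)), 1:]) * [:- k, 1:]"
  proof (rule poly_ext)
    fix x
    show "poly ((char_poly ?B * [:- k, 1:]) * [:- k, 1:]) x
      = poly ((char_poly A * [:- (k + (\<Sum>i<n. w i * u i)), 1:]) * [:- k, 1:]) x"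
    proof (cases "x = k")
      case False
      have lin: "poly [:- a, 1:] x = x - a" for a by simp
      show ?thesis unfolding poly_mult lin main[OF False] ..
    qed simp
  qed
  then show ?thesis by (subst (asm) mult_cancel_right) auto
qed

text \<open>\<open>Q\<close> is the inverse of \<mu> - m, written with sums over \<open>V\<close> so
  that later estimates need no matrices. It is real because the complex characteristic polynomial is
  the image of a real one, whose value at \<mu> is a nonzero determinant.\<close>

lemma char_poly_on_resolvent:
  fixes m :: "'b \<Rightarrow> 'b \<Rightarrow> real" and \<mu> :: real
  assumes V: "finite V"
    and nz: "poly (char_poly_on V (\<lambda>x y. complex_of_real (m x y))) (of_real \<mu>) \<noteq> 0"
  obtains Q where "\<And>u x. x \<in> V \<Longrightarrow>
    (\<Sum>y\<in>V. Q x y * (\<Sum>z\<in>V. ((if y = z then \<mu> else 0) - m y z) * u z)) = u x"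
proof -
  obtain e where e: "bij_betw e {0..<card V} V"
    using ex_bij_betw_nat_finite[OF V] by blast
  let ?n = "card V"
  let ?M = "mat ?n ?n (\<lambda>(i, j). m (e i) (e j))"
  have M: "?M \<in> carrier_mat ?n ?n" by simp
  have "mat ?n ?n (\<lambda>(i, j). complex_of_real (m (e i) (e j))) = map_mat of_real ?M"
    by (rule eq_matI) auto
  then have "poly (char_poly_on V (\<lambda>x y. complex_of_real (m x y))) (of_real \<mu>)
      = of_real (poly (char_poly ?M) \<mu>)"
    by (simp add: char_poly_on_eq_char_poly[OF e] of_real_hom.char_poly_hom[OF M])
  then have "det (- char_matrix ?M \<mu>) \<noteq> 0"
    using nz by (simp add: char_poly_matrix[OF M])
  then have "- char_matrix ?M \<mu> \<in> Units (ring_mat TYPE(real) ?n ())"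
    by (intro det_non_zero_imp_unit) auto
  then obtain B where B: "B \<in> carrier_mat ?n ?n" and BN: "B * (- char_matrix ?M \<mu>) = 1\<^sub>m ?n"
    by (auto simp: Units_def ring_mat_def)
  define N where "N i j = (if i = j then \<mu> else 0) - m (e i) (e j)" for i j
  have BN': "(\<Sum>j = 0..<?n. B $$ (i, j) * N j k) = (if i = k then 1 else 0)"
    if "i < ?n" "k < ?n" for i k
  proof -
    have prod: "(\<Sum>j = 0..<?n. B $$ (i, j) * C $$ (j, k)) = (B * C) $$ (i, k)"
      if "C \<in> carrier_mat ?n ?n" for C
      using B \<open>i < ?n\<close> \<open>k < ?n\<close> that by (simp add: scalar_prod_def)
    have "(\<Sum>j = 0..<?n. B $$ (i, j) * N j k) = (\<Sum>j = 0..<?n. B $$ (i, j) * (- char_matrix ?M \<mu>) $$ (j, k))"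
      using that by (intro sum.cong refl) (auto simp: N_def char_matrix_def)
    also have "\<dots> = (1\<^sub>m ?n) $$ (i, k)"
      unfolding BN[symmetric] by (rule prod) auto
    finally show ?thesis using that by simp
  qed
  define e' where "e' = inv_into {0..<?n} e"
  have e': "e' (e i) = i" if "i < ?n" for i
    using e that by (simp add: e'_def bij_betw_def inv_into_f_f)
  show ?thesis
  proof (rule that[of "\<lambda>x y. B $$ (e' x, e' y)"])
    fix u x assume "x \<in> V"
    then obtain i where i: "i < ?n" "x = e i" using e by (fastforce simp: bij_betw_def)
    have "(\<Sum>y\<in>V. B $$ (e' x, e' y) * (\<Sum>z\<in>V. ((if y = z then \<mu> else 0) - m y z) * u z))
      = (\<Sum>j = 0..<?n. B $$ (i, j) * (\<Sum>k = 0..<?n. N j k * u (e k)))"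
      unfolding sum.reindex_bij_betw[OF e, symmetric] i(2) N_def
      using i(1) e by (intro sum.cong refl arg_cong2[of _ _ _ _ "(*)"])
        (auto simp: e' bij_betw_def inj_on_eq_iff)
    also have "\<dots> = (\<Sum>j = 0..<?n. \<Sum>k = 0..<?n. B $$ (i, j) * N j k * u (e k))"
      by (simp add: sum_distrib_left mult.assoc)
    also have "\<dots> = (\<Sum>k = 0..<?n. (\<Sum>j = 0..<?n. B $$ (i, j) * N j k) * u (e k))"
      by (subst sum.swap) (simp add: sum_distrib_right)
    also have "\<dots> = (\<Sum>k = 0..<?n. if i = k then u (e k) else 0)"
      using i(1) by (intro sum.cong refl) (simp add: BN')
    also have "\<dots> = u x" using i by simp
    finally show "(\<Sum>y\<in>V. B $$ (e' x, e' y) * (\<Sum>z\<in>V. ((if y = z then \<mu> else 0) - m y z) * u z)) = u x" .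
  qed
qed

section \<open>Rayleigh quotients of real symmetric matrices\<close>

lemma quadratic_form_abs_le:
  fixes m :: "'b \<Rightarrow> 'b \<Rightarrow> real"
  assumes V: "finite V"
  shows "\<bar>\<Sum>x\<in>V. \<Sum>y\<in>V. m x y * h x * h y\<bar> \<le> (\<Sum>x\<in>V. \<Sum>y\<in>V. \<bar>m x y\<bar>) * (\<Sum>x\<in>V. (h x)\<^sup>2)"
proof -
  let ?s = "sqrt (\<Sum>x\<in>V. (h x)\<^sup>2)"
  have h: "\<bar>h x\<bar> \<le> ?s" if "x \<in> V" for x
    using member_le_sum[of x V "\<lambda>x. (h x)\<^sup>2"] that V by (intro real_le_rsqrt) simp
  have "\<bar>\<Sum>x\<in>V. \<Sum>y\<in>V. m x y * h x * h y\<bar> \<le> (\<Sum>x\<in>V. \<Sum>y\<in>V. \<bar>m x y * h x * h y\<bar>)"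
    by (rule order_trans[OF sum_abs sum_mono]) (rule sum_abs)
  also have "\<dots> \<le> (\<Sum>x\<in>V. \<Sum>y\<in>V. \<bar>m x y\<bar> * (?s * ?s))"
  proof (intro sum_mono)
    fix x y assume "x \<in> V" "y \<in> V"
    then have "\<bar>h x\<bar> * \<bar>h y\<bar> \<le> ?s * ?s" by (intro mult_mono h) (auto simp: sum_nonneg)
    then show "\<bar>m x y * h x * h y\<bar> \<le> \<bar>m x y\<bar> * (?s * ?s)"
      unfolding abs_mult mult.assoc by (rule mult_left_mono) simp
  qed
  also have "\<dots> = (\<Sum>x\<in>V. \<Sum>y\<in>V. \<bar>m x y\<bar>) * (\<Sum>x\<in>V. (h x)\<^sup>2)"
    by (simp add: sum_distrib_right[symmetric] sum_nonneg)
  finally show ?thesis .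
qed

text \<open>If the supremum \<open>\<mu>\<close> of the Rayleigh quotient is not an eigenvalue, then \<open>\<mu> - m\<close> is positive
  semidefinite and invertible, hence bounded below, which contradicts the choice of \<open>\<mu>\<close>.\<close>
lemma quadratic_form_le_of_char_poly_roots:
  fixes m :: "'b \<Rightarrow> 'b \<Rightarrow> real"
  assumes V: "finite V"
    and sym: "\<And>x y. x \<in> V \<Longrightarrow> y \<in> V \<Longrightarrow> m x y = m y x"
    and roots: "\<And>z. poly (char_poly_on V (\<lambda>x y. complex_of_real (m x y))) (of_real z) = 0 \<Longrightarrow> z \<le> l"
  shows "(\<Sum>x\<in>V. \<Sum>y\<in>V. m x y * h x * h y) \<le> l * (\<Sum>x\<in>V. (h x)\<^sup>2)"
proof -
  define n where "n h = (\<Sum>x\<in>V. (h x)\<^sup>2)" for h :: "'b \<Rightarrow> real"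
  define q where "q h = (\<Sum>x\<in>V. \<Sum>y\<in>V. m x y * h x * h y)" for h
  define R where "R = q ` {h. n h = 1}"
  define \<mu> where "\<mu> = Sup R"
  have n0: "n h \<ge> 0" for h by (simp add: n_def sum_nonneg)
  have bdd: "bdd_above R"
  proof (rule bdd_aboveI)
    fix r assume "r \<in> R"
    then obtain h where "r = q h" "n h = 1" by (auto simp: R_def)
    then show "r \<le> (\<Sum>x\<in>V. \<Sum>y\<in>V. \<bar>m x y\<bar>)"
      using quadratic_form_abs_le[OF V, of m h] by (simp add: n_def q_def)
  qed
  have scale: "q (\<lambda>x. c * h x) = c\<^sup>2 * q h" "n (\<lambda>x. c * h x) = c\<^sup>2 * n h" for c h
    by (simp_all add: q_def n_def sum_distrib_left power2_eq_square mult_ac)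
  have q_le: "q h \<le> \<mu> * n h" for h
  proof (cases "n h = 0")
    case True
    then have "\<forall>x\<in>V. h x = 0" using V by (simp add: n_def sum_nonneg_eq_0_iff)
    then show ?thesis using True by (simp add: q_def)
  next
    case False
    then have pos: "n h > 0" using n0[of h] by simp
    let ?c = "1 / sqrt (n h)"
    have c: "?c\<^sup>2 = 1 / n h" using pos by (simp add: power_divide)
    have "q (\<lambda>x. ?c * h x) \<in> R"
      using pos c unfolding R_def by (intro imageI) (simp only: scale mem_Collect_eq, simp)
    then have "q (\<lambda>x. ?c * h x) \<le> \<mu>" unfolding \<mu>_def by (rule cSup_upper[OF _ bdd])
    then show ?thesis using pos unfolding scale c by (simp add: field_simps)
  qed
  have "\<mu> \<le> l" if ne: "R \<noteq> {}"
  proof (rule ccontr)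
    assume "\<not> \<mu> \<le> l"
    then have "poly (char_poly_on V (\<lambda>x y. complex_of_real (m x y))) (of_real \<mu>) \<noteq> 0"
      using roots by fastforce
    from char_poly_on_resolvent[OF V this] obtain Q where Q: "\<And>u x. x \<in> V \<Longrightarrow>
      (\<Sum>y\<in>V. Q x y * (\<Sum>z\<in>V. ((if y = z then \<mu> else 0) - m y z) * u z)) = u x" by blast
    define N where "N x y = (if x = y then \<mu> else 0) - m x y" for x y
    define p where "p h = (\<Sum>x\<in>V. \<Sum>y\<in>V. N x y * h x * h y)" for h
    define w where "w h x = (\<Sum>y\<in>V. N x y * h y)" for h x
    \<comment> \<open>\<open>C\<close> bounds the form \<open>p\<close> of \<mu> - m relative to
      \<open>n\<close>, and \<open>D\<close> bounds the squared norm of the inverse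
      \<open>Q\<close>; the \<open>+ 1\<close> makes both positive.\<close>
    define C where "C = (\<Sum>x\<in>V. \<Sum>y\<in>V. \<bar>N x y\<bar>) + 1"
    define D where "D = (\<Sum>x\<in>V. (\<Sum>y\<in>V. \<bar>Q x y\<bar>)\<^sup>2) + 1"
    have C: "C > 0" unfolding C_def by (intro add_nonneg_pos sum_nonneg) auto
    have D: "D > 0" unfolding D_def by (intro add_nonneg_pos sum_nonneg) auto
    have p_eq: "p h = \<mu> * n h - q h" for h
    proof -
      have "p h = (\<Sum>x\<in>V. (\<Sum>y\<in>V. if x = y then \<mu> * h x * h y else 0) - (\<Sum>y\<in>V. m x y * h x * h y))"
        unfolding p_def N_def sum_subtractf[symmetric] by (intro sum.cong refl) (auto simp: algebra_simps)
      then show ?thesis using V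
        by (simp add: sum_subtractf q_def n_def sum_distrib_left power2_eq_square mult_ac)
    qed
    have p_le: "p h \<le> C * n h" for h
      using quadratic_form_abs_le[OF V, of N h] n0[of h]
      unfolding p_def n_def C_def by (simp add: algebra_simps)
    have n_le: "n h \<le> D * n (w h)" for h
    proof -
      let ?s = "sqrt (n (w h))"
      have w: "\<bar>w h x\<bar> \<le> ?s" if "x \<in> V" for x
        using member_le_sum[of x V "\<lambda>x. (w h x)\<^sup>2"] that V unfolding n_def by (intro real_le_rsqrt) simp
      have "(h x)\<^sup>2 \<le> (\<Sum>y\<in>V. \<bar>Q x y\<bar>)\<^sup>2 * n (w h)" if "x \<in> V" for x
      proof -
        have "h x = (\<Sum>y\<in>V. Q x y * w h y)" using Q[OF that, of h] by (simp add: w_def N_def)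
        then have "\<bar>h x\<bar> \<le> (\<Sum>y\<in>V. \<bar>Q x y * w h y\<bar>)" by (metis sum_abs)
        also have "\<dots> \<le> (\<Sum>y\<in>V. \<bar>Q x y\<bar> * ?s)"
          by (intro sum_mono) (auto simp: abs_mult intro!: mult_left_mono w)
        also have "\<dots> = (\<Sum>y\<in>V. \<bar>Q x y\<bar>) * ?s" by (simp add: sum_distrib_right)
        finally have "\<bar>h x\<bar>\<^sup>2 \<le> ((\<Sum>y\<in>V. \<bar>Q x y\<bar>) * ?s)\<^sup>2" by (intro power_mono) auto
        then show ?thesis using n0[of "w h"] by (simp add: power_mult_distrib)
      qed
      then have "n h \<le> (\<Sum>x\<in>V. (\<Sum>y\<in>V. \<bar>Q x y\<bar>)\<^sup>2 * n (w h))"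
        unfolding n_def[of h] by (rule sum_mono)
      also have "\<dots> \<le> D * n (w h)"
        using n0[of "w h"] unfolding D_def sum_distrib_right[symmetric] distrib_right by simp
      finally show ?thesis .
    qed
    have p_ge: "n (w h) \<le> C * p h" for h
    proof -
      have symN: "N x y = N y x" if "x \<in> V" "y \<in> V" for x y
        using sym that by (auto simp: N_def)
      have cross: "(\<Sum>x\<in>V. \<Sum>y\<in>V. N x y * w h x * h y) = n (w h)"
        "(\<Sum>x\<in>V. \<Sum>y\<in>V. N x y * h x * w h y) = n (w h)"
      proof -
        show 1: "(\<Sum>x\<in>V. \<Sum>y\<in>V. N x y * w h x * h y) = n (w h)"
          unfolding n_def power2_eq_square
          by (subst (3) w_def) (simp add: sum_distrib_left mult_ac)
        have "(\<Sum>x\<in>V. \<Sum>y\<in>V. N x y * h x * w h y) = (\<Sum>y\<in>V. \<Sum>x\<in>V. N x y * h x * w h y)"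
          by (rule sum.swap)
        also have "\<dots> = (\<Sum>y\<in>V. \<Sum>x\<in>V. N y x * w h y * h x)"
          by (intro sum.cong refl) (simp add: symN mult_ac)
        finally show "(\<Sum>x\<in>V. \<Sum>y\<in>V. N x y * h x * w h y) = n (w h)" using 1 by simp
      qed
      \<comment> \<open>The nonnegative form \<open>p\<close> is evaluated after a gradient step
        from \<open>h\<close> along \<open>w h\<close>. The step length t = 1 / C minimizes the
        upper bound p h - 2 t n (w h) + t^2 C n (w h).\<close>
      let ?t = "1 / C"
      have "p (\<lambda>x. h x - ?t * w h x) = p h - ?t * (\<Sum>x\<in>V. \<Sum>y\<in>V. N x y * w h x * h y)
        - ?t * (\<Sum>x\<in>V. \<Sum>y\<in>V. N x y * h x * w h y) + ?t * ?t * p (w h)"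
        unfolding p_def sum_distrib_left sum_subtractf[symmetric] sum.distrib[symmetric]
        by (intro sum.cong refl) (simp only: algebra_simps)
      also have "\<dots> = p h - 2 * ?t * n (w h) + ?t * ?t * p (w h)"
        unfolding cross by simp
      also have "\<dots> \<le> p h - 2 * ?t * n (w h) + ?t * ?t * (C * n (w h))"
        using p_le[of "w h"] C by (intro add_left_mono mult_left_mono) auto
      also have "\<dots> = p h - ?t * n (w h)" using C by simp
      finally have "0 \<le> p h - ?t * n (w h)"
        using q_le[of "\<lambda>x. h x - ?t * w h x"] unfolding p_eq[of "\<lambda>x. h x - ?t * w h x"] by linarith
      then show ?thesis using C by (simp add: field_simps)
    qed
    \<comment> \<open>\<open>n_le\<close> and \<open>p_ge\<close> give 1 \<le> D C p h on the unit
      sphere, so all Rayleigh quotients stay a fixed amount below their supremum \<mu>.\<close>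
    have "q h \<le> \<mu> - 1 / (D * C)" if "n h = 1" for h
    proof -
      have "1 \<le> D * (C * p h)"
        using n_le[of h] mult_left_mono[OF p_ge[of h], of D] D that by linarith
      then have "1 / (D * C) \<le> p h" using C D by (simp add: field_simps)
      then show ?thesis using that p_eq[of h] by simp
    qed
    then have "\<mu> \<le> \<mu> - 1 / (D * C)"
      unfolding \<mu>_def by (intro cSup_least[OF ne]) (auto simp: R_def \<mu>_def)
    then show False using C D by (simp add: field_simps)
  qed
  \<comment> \<open>An empty \<open>R\<close> gives no information on its \<open>Sup\<close>, but
    then both sides of the final comparison vanish.\<close>
  moreover have "n h = 0" if "R = {}"
  proof (rule ccontr)
    assume "n h \<noteq> 0"
    then have "n (\<lambda>x. 1 / sqrt (n h) * h x) = 1"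
      using n0[of h] unfolding scale by (simp add: power_divide)
    then show False using that by (auto simp: R_def)
  qed
  ultimately have "\<mu> * n h \<le> l * n h"
    using n0[of h] by (cases "R = {}") (auto intro: mult_right_mono)
  with q_le[of h] show ?thesis by (simp add: q_def n_def)
qed

text \<open>Subtracting \<open>c / card V\<close> from every entry moves exactly one eigenvalue \<open>1\<close>, that of the
  constants, to \<open>1 - c\<close>; all eigenvalues of the new matrix are then at most \<open>1 - c\<close>.\<close>
lemma nontrivial_quadratic_form_bound:
  fixes m :: "'b \<Rightarrow> 'b \<Rightarrow> real"
  assumes V: "finite V" "V \<noteq> {}"
    and sym: "\<And>x y. x \<in> V \<Longrightarrow> y \<in> V \<Longrightarrow> m x y = m y x"
    and row: "\<And>x. x \<in> V \<Longrightarrow> (\<Sum>y\<in>V. m x y) = 1"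
    and gap: "\<And>z. z \<in># nontrivial_spectrum_on V (\<lambda>x y. complex_of_real (m x y)) \<Longrightarrow> Re z \<le> 1 - c"
  shows "(\<Sum>x\<in>V. \<Sum>y\<in>V. m x y * h x * h y)
    \<le> (1 - c) * (\<Sum>x\<in>V. (h x)\<^sup>2) + c * (\<Sum>x\<in>V. h x)\<^sup>2 / card V"
proof -
  define J where "J = c / card V"
  define p where "p = char_poly_on V (\<lambda>x y. complex_of_real (m x y))"
  define q where "q = char_poly_on V (\<lambda>x y. complex_of_real (m x y - J))"
  obtain e where e: "bij_betw e {0..<card V} V"
    using ex_bij_betw_nat_finite[OF V(1)] by blast
  let ?n = "card V"
  let ?M = "mat ?n ?n (\<lambda>(i, j). complex_of_real (m (e i) (e j)))"
  have n: "?n > 0" using V by (simp add: card_gt_0_iff)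
  have M: "?M \<in> carrier_mat ?n ?n" by simp
  have "mat ?n ?n (\<lambda>(i, j). complex_of_real (m (e i) (e j) - J))
      = ?M + mat ?n ?n (\<lambda>(i, j). 1 * (- complex_of_real J))"
    by (rule eq_matI) auto
  then have q: "q = char_poly (?M + mat ?n ?n (\<lambda>(i, j). 1 * (- complex_of_real J)))"
    unfolding q_def char_poly_on_eq_char_poly[OF e] by simp
  have p: "p = char_poly ?M" by (simp add: p_def char_poly_on_eq_char_poly[OF e])
  \<comment> \<open>Row sums \<open>1\<close> make the constant vector an eigenvector for
    \<open>1\<close>; the update by \<open>- J\<close> along it moves this eigenvalue to 1 - J card
    V = 1 - c.\<close>
  have eig: "(\<Sum>j<?n. ?M $$ (i, j) * 1) = 1 * 1" if "i < ?n" for i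
  proof -
    have "(\<Sum>j<?n. ?M $$ (i, j) * 1) = (\<Sum>j = 0..<?n. complex_of_real (m (e i) (e j)))"
      using that by (simp add: atLeast0LessThan)
    also have "\<dots> = (\<Sum>y\<in>V. complex_of_real (m (e i) y))"
      by (rule sum.reindex_bij_betw[OF e])
    also have "\<dots> = of_real (\<Sum>y\<in>V. m (e i) y)" by simp
    also have "\<dots> = 1" using e that by (subst row) (auto simp: bij_betw_def)
    finally show ?thesis by simp
  qed
  have "q * [:- 1, 1:] = p * [:- (1 + (\<Sum>i<?n. - complex_of_real J * 1)), 1:]"
    unfolding p q by (rule char_poly_rank_one_deflation[OF M]) (use eig in auto)
  moreover have "(\<Sum>i<?n. - complex_of_real J * 1) = - of_real c"
    using n by (simp add: J_def)
  ultimately have pq: "q * [:- 1, 1:] = p * [:- of_real (1 - c), 1:]" by simp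
  have p0: "p \<noteq> 0" using degree_monic_char_poly[OF M] p by auto
  have "q * [:- 1, 1:] \<noteq> 0" unfolding pq mult_eq_0_iff using p0 by simp
  then have q0: "q \<noteq> 0" by auto
  \<comment> \<open>Roots are counted with multiplicity: one copy of \<open>1\<close> is exchanged
    for \<open>1 - c\<close>, matching the single copy removed in
    \<open>nontrivial_spectrum_on\<close>.\<close>
  have count: "proots q + {#1#} = proots p + {#of_real (1 - c)#}"
    using arg_cong[OF pq, of proots] p0 q0 by (subst (asm) (1 2) proots_mult) auto
  then have spec: "proots q \<subseteq># add_mset (of_real (1 - c)) (proots p - {#1#})"
  proof (intro mset_subset_eqI)
    fix z
    show "count (proots q) z \<le> count (add_mset (of_real (1 - c)) (proots p - {#1#})) z"
      using arg_cong[OF count, of "\<lambda>M. count M z"] by (auto split: if_splits)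
  qed
  have "(\<Sum>x\<in>V. \<Sum>y\<in>V. (m x y - J) * h x * h y) \<le> (1 - c) * (\<Sum>x\<in>V. (h x)\<^sup>2)"
  proof (rule quadratic_form_le_of_char_poly_roots[OF V(1)])
    fix z assume "poly (char_poly_on V (\<lambda>x y. complex_of_real (m x y - J))) (of_real z) = 0"
    then have "of_real z \<in># proots q" using q0 by (simp add: q_def)
    then have "complex_of_real z = of_real (1 - c) \<or> of_real z \<in># proots p - {#1#}"
      using mset_subset_eqD[OF spec] by auto
    then show "z \<le> 1 - c"
      using gap[of "of_real z"] by (auto simp: nontrivial_spectrum_on_def spectrum_on_def p_def
          simp flip: of_real_diff dest: of_real_eq_iff[THEN iffD1])
  qed (simp add: sym)
  moreover have "(\<Sum>x\<in>V. \<Sum>y\<in>V. (m x y - J) * h x * h y)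
      = (\<Sum>x\<in>V. \<Sum>y\<in>V. m x y * h x * h y) - J * (\<Sum>x\<in>V. h x)\<^sup>2"
    by (simp add: algebra_simps sum_subtractf power2_eq_square sum_product sum_distrib_left)
  ultimately show ?thesis by (simp add: J_def)
qed

section \<open>Foelner sets\<close>

text \<open>Rado's argument: remove as many edges as possible while keeping Hall's condition. If two edges
  at the same vertex survived, each would lie on a critical finite set, and the union and
  intersection of these two sets would violate the condition.\<close>
lemma infinite_hall:
  fixes A :: "'i \<Rightarrow> 'c set"
  assumes fin: "\<And>i. i \<in> I \<Longrightarrow> finite (A i)"
    and hall: "\<And>J. finite J \<Longrightarrow> J \<subseteq> I \<Longrightarrow> card J \<le> card (\<Union>i\<in>J. A i)"
  obtains f where "\<And>i. i \<in> I \<Longrightarrow> f i \<in> A i" "inj_on f I"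
proof -
  define H where "H R \<longleftrightarrow> (\<forall>J. finite J \<longrightarrow> J \<subseteq> I \<longrightarrow> card J \<le> card (R `` J))" for R :: "('i \<times> 'c) set"
  \<comment> \<open>Graphs are recorded by their removed edges, so that a maximal element in Zorn's
    lemma is a minimal remaining graph \<open>R\<close>.\<close>
  define D where "D = {M. M \<subseteq> Sigma I A \<and> H (Sigma I A - M)}"
  have fin_img: "finite (R `` J)" if "R \<subseteq> Sigma I A" "finite J" for R J
  proof (rule finite_subset)
    show "R `` J \<subseteq> (\<Union>i\<in>J \<inter> I. A i)" using that by auto
    show "finite (\<Union>i\<in>J \<inter> I. A i)" using that fin by auto
  qed
  have "\<exists>M\<in>D. \<forall>X\<in>D. M \<subseteq> X \<longrightarrow> X = M"
  proof (rule subset_Zorn')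
    fix \<C> assume chain: "subset.chain D \<C>"
    then have sub: "\<C> \<subseteq> D" by (simp add: subset.chain_def)
    show "\<Union>\<C> \<in> D"
    proof (cases "\<C> = {}")
      case True
      have "card J \<le> card (Sigma I A `` J)" if "finite J" "J \<subseteq> I" for J
      proof -
        have "Sigma I A `` J = (\<Union>i\<in>J. A i)" using that by auto
        then show ?thesis using hall that by simp
      qed
      then show ?thesis using True by (simp add: D_def H_def)
    next
      case False
      have "card J \<le> card ((Sigma I A - \<Union>\<C>) `` J)" if J: "finite J" "J \<subseteq> I" for J
      proof -
        \<comment> \<open>Hall's condition for \<open>J\<close> involves only the finitely many
          edges at \<open>J\<close>; those removed by the whole chain are already removed by one
          member.\<close>
        have "finite (\<Union>\<C> \<inter> Sigma J A)"
          using J fin by (intro finite_Int disjI2 finite_SigmaI) auto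
        from finite_subset_Union_chain[OF this _ False chain]
        obtain M where M: "M \<in> \<C>" "\<Union>\<C> \<inter> Sigma J A \<subseteq> M" by blast
        have "(Sigma I A - \<Union>\<C>) `` J = (Sigma I A - M) `` J" using M J by blast
        then show ?thesis using M sub J by (auto simp: D_def H_def)
      qed
      then show ?thesis using sub by (auto simp: D_def H_def)
    qed
  qed
  then obtain M where M: "M \<in> D" and max: "\<And>X. X \<in> D \<Longrightarrow> M \<subseteq> X \<Longrightarrow> X = M" by blast
  define R where "R = Sigma I A - M"
  have R: "R \<subseteq> Sigma I A" and HR: "H R" using M by (auto simp: D_def R_def)
  have HR': "card J \<le> card (R `` J)" if "finite J" "J \<subseteq> I" for J
    using HR that unfolding H_def by blast
  have critical: "\<exists>J. finite J \<and> J \<subseteq> I \<and> i \<in> J \<and> card ((R - {(i, x)}) `` J) < card J"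
    if x: "(i, x) \<in> R" for i x
  proof -
    have "insert (i, x) M \<notin> D" using max[of "insert (i, x) M"] x by (auto simp: R_def)
    moreover have "Sigma I A - insert (i, x) M = R - {(i, x)}" by (auto simp: R_def)
    ultimately have "\<not> H (R - {(i, x)})" using M x R by (auto simp: D_def)
    then obtain J where J: "finite J" "J \<subseteq> I" "card ((R - {(i, x)}) `` J) < card J"
      by (auto simp: H_def not_le)
    moreover have "i \<in> J"
    proof (rule ccontr)
      assume "i \<notin> J"
      then have "(R - {(i, x)}) `` J = R `` J" by auto
      then show False using J(3) HR'[OF J(1,2)] by simp
    qed
    ultimately show ?thesis by blast
  qed
  have uniq: "x = y" if x: "(i, x) \<in> R" and y: "(i, y) \<in> R" for i x y
  proof (rule ccontr)
    assume "x \<noteq> y"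
    obtain J where J: "finite J" "J \<subseteq> I" "i \<in> J" "card ((R - {(i, x)}) `` J) < card J"
      using critical[OF x] by blast
    obtain K where K: "finite K" "K \<subseteq> I" "i \<in> K" "card ((R - {(i, y)}) `` K) < card K"
      using critical[OF y] by blast
    \<comment> \<open>As \<open>x\<close> and \<open>y\<close> differ, \<open>?P\<close> and
      \<open>?Q\<close> together still cover all neighbours of \<open>J \<union> K\<close>, and
      their intersection contains those of \<open>J \<inter> K - {i}\<close>. Hence their
      cardinalities sum to at least card J + card K - 1, while criticality allows at most card J +
      card K - 2.\<close>
    let ?P = "(R - {(i, x)}) `` J" and ?Q = "(R - {(i, y)}) `` K"
    have PQ: "finite ?P" "finite ?Q" using R J K by (auto intro!: fin_img)
    have "card (J \<union> K) \<le> card (R `` (J \<union> K))" by (rule HR') (use J K in auto)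
    also have "\<dots> \<le> card (?P \<union> ?Q)"
      using PQ \<open>x \<noteq> y\<close> J K by (intro card_mono) auto
    finally have 1: "card (J \<union> K) \<le> card (?P \<union> ?Q)" .
    have "card (J \<inter> K - {i}) \<le> card (R `` (J \<inter> K - {i}))"
      by (rule HR') (use J K in auto)
    also have "\<dots> \<le> card (?P \<inter> ?Q)"
      using PQ by (intro card_mono) auto
    finally have 2: "card (J \<inter> K) \<le> card (?P \<inter> ?Q) + 1"
      using J K by simp
    show False
      using 1 2 J(4) K(4) card_Un_Int[OF PQ] card_Un_Int[OF J(1) K(1)] by linarith
  qed
  have ex: "\<exists>x. (i, x) \<in> R" if "i \<in> I" for i
  proof -
    have "card {i} \<le> card (R `` {i})" using that by (intro HR') auto
    then have "R `` {i} \<noteq> {}" by (auto simp del: Image_singleton_iff)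
    then show ?thesis by auto
  qed
  define f where "f i = (SOME x. (i, x) \<in> R)" for i
  have f: "(i, f i) \<in> R" if "i \<in> I" for i using someI_ex[OF ex[OF that]] by (simp add: f_def)
  show ?thesis
  proof
    show "f i \<in> A i" if "i \<in> I" for i using f[OF that] R by auto
    show "inj_on f I"
    proof (rule inj_onI, rule ccontr)
      fix i j assume ij: "i \<in> I" "j \<in> I" "f i = f j" "i \<noteq> j"
      have "(i, f i) \<in> R" "(j, f i) \<in> R" using f[OF ij(1)] f[OF ij(2)] ij(3) by simp_all
      then have "R `` {i, j} = {f i}" using uniq by blast
      moreover have "card {i, j} \<le> card (R `` {i, j})" using ij by (intro HR') auto
      ultimately show False using ij by simp
    qed
  qed
qed

lemma finitely_additive_UN:
  fixes \<mu> :: "'a set \<Rightarrow> real"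
  assumes add: "\<And>A B. A \<subseteq> \<Omega> \<Longrightarrow> B \<subseteq> \<Omega> \<Longrightarrow> A \<inter> B = {} \<Longrightarrow> \<mu> (A \<union> B) = \<mu> A + \<mu> B"
    and I: "finite I" and sub: "\<And>i. i \<in> I \<Longrightarrow> A i \<subseteq> \<Omega>"
    and disj: "\<And>i j. i \<in> I \<Longrightarrow> j \<in> I \<Longrightarrow> i \<noteq> j \<Longrightarrow> A i \<inter> A j = {}"
  shows "\<mu> (\<Union>i\<in>I. A i) = (\<Sum>i\<in>I. \<mu> (A i))"
  using I sub disj
proof (induction I rule: finite_induct)
  case empty
  show ?case using add[of "{}" "{}"] by simp
next
  case (insert i I)
  have "\<mu> (A i \<union> (\<Union>j\<in>I. A j)) = \<mu> (A i) + \<mu> (\<Union>j\<in>I. A j)"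
    using insert.prems insert.hyps by (intro add) blast+
  then show ?case using insert by simp
qed

text \<open>If every finite set were at least doubled by \<open>K\<close>, Hall's theorem would produce a paradoxical
  decomposition of the group into pieces translated by elements of \<open>K\<close>.\<close>
lemma (in group) amenable_not_doubling:
  assumes amen: "amenable G" and K: "finite K" "K \<subseteq> carrier G"
  obtains F where "finite F" "F \<noteq> {}" "F \<subseteq> carrier G" "card (K <#> F) < 2 * card F"
proof (rule ccontr)
  note obtained = that
  assume "\<not> thesis"
  then have doubling: "2 * card F \<le> card (K <#> F)" if "finite F" "F \<noteq> {}" "F \<subseteq> carrier G" for F
    using that obtained by (meson not_le)
  obtain \<mu> :: "'a set \<Rightarrow> real" where \<mu>: "(\<forall>A. A \<subseteq> carrier G \<longrightarrow> \<mu> A \<ge> 0) \<and> \<mu> (carrier G) = 1 \<and>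
      (\<forall>A B. A \<subseteq> carrier G \<longrightarrow> B \<subseteq> carrier G \<longrightarrow> A \<inter> B = {} \<longrightarrow> \<mu> (A \<union> B) = \<mu> A + \<mu> B) \<and>
      (\<forall>g \<in> carrier G. \<forall>A. A \<subseteq> carrier G \<longrightarrow> \<mu> (l_coset G g A) = \<mu> A)"
    using amen unfolding amenable_def by (rule exE)
  then have nonneg: "\<And>A. A \<subseteq> carrier G \<Longrightarrow> \<mu> A \<ge> 0"
    and one: "\<mu> (carrier G) = 1"
    and add: "\<And>A B. A \<subseteq> carrier G \<Longrightarrow> B \<subseteq> carrier G \<Longrightarrow> A \<inter> B = {} \<Longrightarrow> \<mu> (A \<union> B) = \<mu> A + \<mu> B"
    and inv: "\<And>g A. g \<in> carrier G \<Longrightarrow> A \<subseteq> carrier G \<Longrightarrow> \<mu> (l_coset G g A) = \<mu> A"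
    by auto
  \<comment> \<open>Each group element x is taken in two copies, both with neighbours K x; Hall's
    condition for them follows from the doubling assumption.\<close>
  let ?I = "carrier G \<times> (UNIV :: bool set)"
  define N where "N i = (\<lambda>k. k \<otimes> fst i) ` K" for i :: "'a \<times> bool"
  obtain f where f: "\<And>i. i \<in> ?I \<Longrightarrow> f i \<in> N i" "inj_on f ?I"
  proof (rule infinite_hall[of ?I N])
    show "finite (N i)" for i using K by (simp add: N_def)
    fix J assume J: "finite J" "J \<subseteq> ?I"
    show "card J \<le> card (\<Union>i\<in>J. N i)"
    proof (cases "J = {}")
      case False
      have "card J \<le> card (fst ` J \<times> (UNIV :: bool set))"
        using J by (intro card_mono) force+
      also have "\<dots> = 2 * card (fst ` J)" by (simp add: card_cartesian_product)
      also have "\<dots> \<le> card (K <#> fst ` J)" using J False by (intro doubling) auto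
      also have "K <#> fst ` J = (\<Union>i\<in>J. N i)" by (auto simp: set_mult_def N_def)
      finally show ?thesis .
    qed simp
  qed blast
  have "\<exists>k\<in>K. f i = k \<otimes> fst i" if "i \<in> ?I" for i using f(1)[OF that] by (auto simp: N_def)
  then obtain \<kappa> where \<kappa>: "\<And>i. i \<in> ?I \<Longrightarrow> \<kappa> i \<in> K" "\<And>i. i \<in> ?I \<Longrightarrow> f i = \<kappa> i \<otimes> fst i" by metis
  \<comment> \<open>For either \<open>b\<close> the sets \<open>B k b\<close> partition the group,
    and injectivity of \<open>f\<close> makes the translates of all of them disjoint. By invariance
    these have total measure 2, too much for a group of measure 1.\<close>
  define B where "B k b = {x \<in> carrier G. \<kappa> (x, b) = k}" for k b
  have B: "B k b \<subseteq> carrier G" for k b by (auto simp: B_def)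
  have "\<mu> (\<Union>k\<in>K. B k b) = (\<Sum>k\<in>K. \<mu> (B k b))" for b
    by (rule finitely_additive_UN[of "carrier G"]) (auto simp: B_def K add)
  moreover have "(\<Union>k\<in>K. B k b) = carrier G" for b using \<kappa>(1) by (auto simp: B_def)
  ultimately have sumB: "(\<Sum>k\<in>K. \<mu> (B k b)) = 1" for b using one by simp
  let ?T = "\<lambda>(k, b). l_coset G k (B k b)"
  have T: "?T i \<subseteq> carrier G" if "i \<in> K \<times> UNIV" for i
    using that K l_coset_subset_G[OF B[of "fst i" "snd i"], of "fst i"]
    by (cases i) auto
  have elem: "\<exists>x\<in>carrier G. \<kappa> (x, b) = k \<and> z = f (x, b)" if "z \<in> ?T (k, b)" for z k b
    using that \<kappa>(2) by (force simp: l_coset_def B_def)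
  have disj: "?T i \<inter> ?T j = {}" if "i \<noteq> j" for i j
  proof (rule ccontr)
    assume "?T i \<inter> ?T j \<noteq> {}"
    then obtain z where z: "z \<in> ?T i" "z \<in> ?T j" by blast
    obtain k b where i: "i = (k, b)" by fastforce
    obtain l c where j: "j = (l, c)" by fastforce
    obtain x where x: "x \<in> carrier G" "\<kappa> (x, b) = k" "z = f (x, b)"
      using elem[of z k b] z i by auto
    obtain y where y: "y \<in> carrier G" "\<kappa> (y, c) = l" "z = f (y, c)"
      using elem[of z l c] z j by auto
    have "(x, b) = (y, c)" using inj_onD[OF f(2), of "(x, b)" "(y, c)"] x y by auto
    then show False using x y i j that by auto
  qed
  have "(\<Sum>i\<in>K \<times> UNIV. \<mu> (?T i)) = \<mu> (\<Union>i\<in>K \<times> UNIV. ?T i)"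
    by (rule finitely_additive_UN[of "carrier G", symmetric])
      (rule add T disj; assumption | simp add: K)+
  also have "\<dots> \<le> \<mu> (\<Union>i\<in>K \<times> UNIV. ?T i) + \<mu> (carrier G - (\<Union>i\<in>K \<times> UNIV. ?T i))"
    using nonneg[of "carrier G - (\<Union>i\<in>K \<times> UNIV. ?T i)"] by auto
  also have "\<dots> = \<mu> ((\<Union>i\<in>K \<times> UNIV. ?T i) \<union> (carrier G - (\<Union>i\<in>K \<times> UNIV. ?T i)))"
    using T by (intro add[symmetric] UN_least) auto
  also have "(\<Union>i\<in>K \<times> UNIV. ?T i) \<union> (carrier G - (\<Union>i\<in>K \<times> UNIV. ?T i)) = carrier G"
    using UN_least[of "K \<times> UNIV" ?T, OF T] by blast
  also have "(\<Sum>i\<in>K \<times> UNIV. \<mu> (?T i)) = (\<Sum>i\<in>K \<times> UNIV. \<mu> (B (fst i) (snd i)))"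
    using K B by (intro sum.cong refl) (auto simp: inv)
  also have "\<dots> = (\<Sum>k\<in>K. \<Sum>b\<in>UNIV. \<mu> (B k b))"
    by (simp add: sum.cartesian_product split_def)
  also have "\<dots> = 2" by (subst sum.swap) (simp add: sumB)
  finally show False using one by simp
qed

text \<open>If \<open>K\<close> enlarged every finite set by a factor 1 + \<epsilon>, its n-fold
  product set \<open>P n\<close> would enlarge it by (1 + \<epsilon>)^n, which exceeds 2 for some n,
  against \<open>amenable_not_doubling\<close> for \<open>P n\<close>.\<close>

lemma (in group) amenable_small_growth:
  fixes \<epsilon> :: real
  assumes amen: "amenable G" and K: "finite K" "K \<subseteq> carrier G" and eps: "\<epsilon> > 0"
  obtains F where "finite F" "F \<noteq> {}" "F \<subseteq> carrier G" "card (K <#> F) < (1 + \<epsilon>) * card F"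
proof (rule ccontr)
  note obtained = that
  assume "\<not> thesis"
  then have growth: "(1 + \<epsilon>) * card F \<le> card (K <#> F)" if "finite F" "F \<subseteq> carrier G" for F
  proof (cases "F = {}")
    case False
    then show ?thesis using that \<open>\<not> thesis\<close> obtained by (meson not_le)
  qed simp
  have fin_mult: "finite (A <#> F)" if "finite A" "finite F" for A F
    using that by (simp add: set_mult_def)
  define P where "P n = ((<#>) K ^^ n) {\<one>}" for n
  have P: "finite (P n) \<and> P n \<subseteq> carrier G" for n
    by (induction n) (simp_all add: P_def fin_mult K set_mult_closed)
  have iter: "(1 + \<epsilon>) ^ n * card F \<le> card (P n <#> F)" if F: "finite F" "F \<subseteq> carrier G" for n F
  proof (induction n)
    case 0
    have "{\<one>} <#> F = F" using F by (force simp: set_mult_def)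
    then show ?case by (simp add: P_def)
  next
    case (Suc n)
    have "(1 + \<epsilon>) ^ Suc n * card F \<le> (1 + \<epsilon>) * card (P n <#> F)"
      using mult_left_mono[OF Suc, of "1 + \<epsilon>"] eps by (simp add: mult.assoc)
    also have "\<dots> \<le> card (K <#> (P n <#> F))"
      using F P[of n] by (intro growth fin_mult set_mult_closed) auto
    also have "K <#> (P n <#> F) = P (Suc n) <#> F"
      using F P[of n] K by (simp add: P_def set_mult_assoc)
    finally show ?case .
  qed
  obtain n where n: "(1 + \<epsilon>) ^ n > 2" using real_arch_pow[of "1 + \<epsilon>" 2] eps by auto
  obtain F where F: "finite F" "F \<noteq> {}" "F \<subseteq> carrier G" "card (P n <#> F) < 2 * card F"
    using amenable_not_doubling[OF amen, of "P n"] P by blast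
  have "2 * real (card F) \<le> (1 + \<epsilon>) ^ n * card F" using n by (intro mult_right_mono) auto
  also have "\<dots> \<le> card (P n <#> F)" by (rule iter[OF F(1,3)])
  finally show False using F(4) by linarith
qed

text \<open>With \<open>\<one>\<close> adjoined to \<open>K\<close>, the product set contains
  \<open>F\<close>, so small growth bounds the number of its elements outside \<open>F\<close>, and
  each k F - F lies among them.\<close>

lemma (in group) amenable_foelner:
  fixes \<epsilon> :: real
  assumes amen: "amenable G" and K: "finite K" "K \<subseteq> carrier G" and eps: "\<epsilon> > 0"
  obtains F where "finite F" "F \<noteq> {}" "F \<subseteq> carrier G"
    "\<And>k. k \<in> K \<Longrightarrow> card (l_coset G k F - F) \<le> \<epsilon> * card F"
proof -
  obtain F where F: "finite F" "F \<noteq> {}" "F \<subseteq> carrier G"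
    and small: "card (insert \<one> K <#> F) < (1 + \<epsilon>) * card F"
    using amenable_small_growth[OF amen, of "insert \<one> K"] K eps by auto
  have fin: "finite (insert \<one> K <#> F)" using F K by (simp add: set_mult_def)
  have "F \<subseteq> insert \<one> K <#> F" using F by (force simp: set_mult_def)
  then have "card ((insert \<one> K <#> F) - F) = card (insert \<one> K <#> F) - real (card F)"
    using F fin by (simp add: card_Diff_subset card_mono of_nat_diff)
  moreover have "card (l_coset G k F - F) \<le> card ((insert \<one> K <#> F) - F)" if "k \<in> K" for k
    using that fin by (intro card_mono) (auto simp: set_mult_def l_coset_def)
  ultimately have "card (l_coset G k F - F) \<le> \<epsilon> * card F" if "k \<in> K" for k
    using small that by (fastforce simp: algebra_simps)
  with F that show thesis by blast
qed

section \<open>Finite quotients\<close>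

text \<open>A homomorphism to a group of order at most \<open>N\<close> is determined up to isomorphism by the
  left translation action of the generators, transported to \<open>{0..<N}\<close>.\<close>
lemma (in group) exists_large_quotient:
  fixes Gi :: "nat \<Rightarrow> ('c, 'd) monoid_scheme" and N :: nat
  assumes gen: "finite \<Sigma>" "\<Sigma> \<subseteq> carrier G" "generate G \<Sigma> = carrier G"
    and Gi: "\<And>i. group (Gi i)" "\<And>i. finite (carrier (Gi i))"
    and hom: "\<And>i. \<pi> i \<in> hom G (Gi i)"
    and ker: "\<And>i j. i \<noteq> j \<Longrightarrow> kernel G (Gi i) (\<pi> i) \<noteq> kernel G (Gi j) (\<pi> j)"
  obtains i where "N < card (carrier (Gi i))"
proof (rule ccontr)
  assume "\<not> thesis"
  then have le: "card (carrier (Gi i)) \<le> N" for i using that not_le by blast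
  define n where "n i = card (carrier (Gi i))" for i
  have "\<exists>e. \<forall>i. bij_betw (e i) {0..<n i} (carrier (Gi i))"
    using ex_bij_betw_nat_finite[OF Gi(2)] unfolding n_def by metis
  then obtain e where e: "\<And>i. bij_betw (e i) {0..<n i} (carrier (Gi i))" by blast
  have gh: "group_hom G (Gi i) (\<pi> i)" for i
    using Gi(1) hom by (simp add: group_hom_def group_hom_axioms_def is_group)
  define act where "act i x m = inv_into {0..<n i} (e i) (\<pi> i x \<otimes>\<^bsub>Gi i\<^esub> e i m)" for i x m
  have e_in: "e i m \<in> carrier (Gi i)" if "m < n i" for i m
    using bij_betwE[OF e[of i]] that by simp
  have pi_in: "\<pi> i x \<in> carrier (Gi i)" if "x \<in> carrier G" for i x
    using group_hom.hom_closed[OF gh that] .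
  have prod_in: "\<pi> i x \<otimes>\<^bsub>Gi i\<^esub> e i m \<in> carrier (Gi i)" if "x \<in> carrier G" "m < n i" for i x m
    using pi_in[OF that(1), of i] e_in[OF that(2)] Gi(1)[of i] by (simp add: group.is_monoid monoid.m_closed)
  have e_act: "e i (act i x m) = \<pi> i x \<otimes>\<^bsub>Gi i\<^esub> e i m" if "x \<in> carrier G" "m < n i" for i x m
    using prod_in[OF that] e[of i] unfolding act_def by (metis bij_betw_inv_into_right)
  have act_less: "act i x m < n i" if "x \<in> carrier G" "m < n i" for i x m
    using prod_in[OF that] bij_betwE[OF bij_betw_inv_into[OF e[of i]]] unfolding act_def by auto
  have e_inj: "a = b" if "e i a = e i b" "a < n i" "b < n i" for i a b
    using inj_onD[OF bij_betw_imp_inj_on[OF e[of i]] that(1)] that by auto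
  have act_one: "act i \<one> m = m" if "m < n i" for i m
    using that e_in[OF that] e_act[of \<one> m i] act_less[of \<one> m i] Gi(1)[of i]
    by (intro e_inj[of i]) (auto simp: group_hom.hom_one[OF gh] group.is_monoid monoid.l_one)
  have act_mult: "act i (x \<otimes> y) m = act i x (act i y m)"
    if "x \<in> carrier G" "y \<in> carrier G" "m < n i" for i x y m
  proof (rule e_inj[of i])
    show "e i (act i (x \<otimes> y) m) = e i (act i x (act i y m))"
      using that Gi(1)[of i] pi_in[of x i] pi_in[of y i] e_in[of m i]
      by (simp add: e_act act_less group_hom.hom_mult[OF gh] group.is_monoid monoid.m_assoc)
  qed (use that in \<open>auto intro: act_less\<close>)
  \<comment> \<open>Translation acts freely, so the single fixed point \<open>0\<close> already
    forces \<open>\<pi> i x\<close> to be the identity; the kernel can thus be read off from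
    \<open>act\<close>.\<close>
  have kernel_iff: "x \<in> kernel G (Gi i) (\<pi> i) \<longleftrightarrow> (\<forall>m<n i. act i x m = m)"
    if x: "x \<in> carrier G" for i x
  proof
    assume "x \<in> kernel G (Gi i) (\<pi> i)"
    then have "\<pi> i x = \<one>\<^bsub>Gi i\<^esub>" by (simp add: kernel_def)
    then have "act i x m = act i \<one> m" for m
      by (simp add: act_def group_hom.hom_one[OF gh])
    then show "\<forall>m<n i. act i x m = m" by (simp add: act_one)
  next
    assume fixed: "\<forall>m<n i. act i x m = m"
    have "0 < n i"
      using Gi(2)[of i] group.is_monoid[OF Gi(1)[of i]] monoid.one_closed[of "Gi i"]
      by (auto simp: n_def card_gt_0_iff)
    then have "\<pi> i x \<otimes>\<^bsub>Gi i\<^esub> e i 0 = e i 0" using e_act[OF x, of 0 i] fixed by simp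
    then have "\<pi> i x = \<one>\<^bsub>Gi i\<^esub>"
      using pi_in[OF x, of i] e_in[OF \<open>0 < n i\<close>] group.r_cancel_one'[OF Gi(1)[of i]] by metis
    then show "x \<in> kernel G (Gi i) (\<pi> i)" using x by (simp add: kernel_def)
  qed
  \<comment> \<open>The default \<open>0\<close> beyond \<open>n i\<close> and the restriction to
    \<open>\<Sigma>\<close> and \<open>{0..<N}\<close> place all codes in one finite set, so two
    indices share a code.\<close>
  define code where "code i = (n i, \<lambda>s\<in>\<Sigma>. \<lambda>m\<in>{0..<N}. if m < n i then act i s m else 0)" for i
  have "code i \<in> {..N} \<times> (\<Sigma> \<rightarrow>\<^sub>E ({0..<N} \<rightarrow>\<^sub>E {..N}))" for i
    using le[of i] gen act_less[of _ _ i]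
    by (auto simp: code_def n_def[symmetric] intro!: less_imp_le[OF less_le_trans[OF act_less]])
  then have "range code \<subseteq> {..N} \<times> (\<Sigma> \<rightarrow>\<^sub>E ({0..<N} \<rightarrow>\<^sub>E {..N}))" by blast
  moreover have "finite ({..N} \<times> (\<Sigma> \<rightarrow>\<^sub>E ({0..<N} \<rightarrow>\<^sub>E {..N})))"
    using gen by (intro finite_cartesian_product finite_PiE) auto
  ultimately have "\<not> inj code" using finite_subset finite_imageD by fastforce
  then obtain i j where ij: "i \<noteq> j" "code i = code j" by (auto simp: inj_on_def)
  have nn: "n i = n j" using ij by (simp add: code_def)
  have gen_eq: "act i s m = act j s m" if "s \<in> \<Sigma>" "m < n i" for s m
  proof -
    have "m < N" using that le[of i] by (simp add: n_def)
    then show ?thesis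
      using fun_cong[OF fun_cong[OF arg_cong[OF ij(2), of snd], of s], of m] that nn
      by (simp add: code_def)
  qed
  have act_eq: "act i x m = act j x m" if "x \<in> generate G \<Sigma>" "m < n i" for x m
    using that
  proof (induction x arbitrary: m rule: generate.induct)
    case one
    then show ?case using nn by (simp add: act_one)
  next
    case (incl h)
    then show ?case by (simp add: gen_eq)
  next
    case (inv h)
    then have h: "h \<in> carrier G" using gen by auto
    \<comment> \<open>\<open>m'\<close> is the preimage of \<open>m\<close> under the action of
      \<open>h\<close> at \<open>i\<close>; as \<open>h\<close> acts alike at \<open>j\<close>, it
      is the preimage there as well.\<close>
    define m' where "m' = act i (inv h) m"
    have m': "m' < n i" using h inv by (simp add: m'_def act_less)
    have "act j h m' = act i h m'" using inv m' by (simp add: gen_eq)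
    also have "\<dots> = m" unfolding m'_def using h inv act_mult[of h "inv h" m i] by (simp add: act_one)
    finally have "act j (inv h) m = act j (inv h) (act j h m')" by simp
    also have "\<dots> = m'" using h m' nn act_mult[of "inv h" h m' j] by (simp add: act_one)
    finally show ?case by (simp add: m'_def)
  next
    case (eng h1 h2)
    then have "h1 \<in> carrier G" "h2 \<in> carrier G" using gen by auto
    then show ?case using eng nn by (simp add: act_mult act_less)
  qed
  have "kernel G (Gi i) (\<pi> i) = kernel G (Gi j) (\<pi> j)"
  proof (rule Set.set_eqI)
    fix x
    show "x \<in> kernel G (Gi i) (\<pi> i) \<longleftrightarrow> x \<in> kernel G (Gi j) (\<pi> j)"
    proof (cases "x \<in> carrier G")
      case True
      then show ?thesis using act_eq[of x] nn gen by (simp add: kernel_iff)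
    qed (simp add: kernel_def)
  qed
  then show False using ker ij by blast
qed

section \<open>Almost invariant functions on finite groups\<close>

lemma (in group) mult_inv_cancel_left:
  assumes "x \<in> carrier G" "y \<in> carrier G"
  shows "x \<otimes> (inv x \<otimes> y) = y" "inv x \<otimes> (x \<otimes> y) = y"
  using assms by (simp_all flip: m_assoc)

text \<open>Let \<phi>(y) = \<gamma> y t \<gamma>^-1. Then \<phi>(y) = (\<gamma> y) (t \<gamma>^-1),
  and centrality of \<gamma>^2 gives \<gamma> \<phi>(y) = y (t \<gamma>). So F(\<phi>(y)) - F(y)
  splits into a right translation of \<open>f\<close> by t \<gamma>^-1 at \<gamma> y and one by t
  \<gamma> at y, of total size at most 2 \<delta>.\<close>

lemma (in group) sqrt_correlation_ge:
  fixes f :: "'a \<Rightarrow> real"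
  assumes fin: "finite (carrier G)" and \<gamma>: "\<gamma> \<in> carrier G" and t: "t \<in> carrier G"
    and central: "\<And>x. x \<in> carrier G \<Longrightarrow> \<gamma> \<otimes> \<gamma> \<otimes> x = x \<otimes> (\<gamma> \<otimes> \<gamma>)"
    and f: "\<And>x. x \<in> carrier G \<Longrightarrow> f x \<ge> 0"
    and d1: "(\<Sum>y\<in>carrier G. \<bar>f (y \<otimes> (t \<otimes> inv \<gamma>)) - f y\<bar>) \<le> \<delta>"
    and d2: "(\<Sum>y\<in>carrier G. \<bar>f (y \<otimes> (t \<otimes> \<gamma>)) - f y\<bar>) \<le> \<delta>"
    and F: "\<And>y. F y = f y + f (\<gamma> \<otimes> y)"
  shows "(\<Sum>y\<in>carrier G. F y) - \<delta> \<le> (\<Sum>y\<in>carrier G. sqrt (F y) * sqrt (F (\<gamma> \<otimes> (y \<otimes> t) \<otimes> inv \<gamma>)))"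
proof -
  let ?\<phi> = "\<lambda>y. \<gamma> \<otimes> (y \<otimes> t) \<otimes> inv \<gamma>"
  have bij: "bij_betw ?\<phi> (carrier G) (carrier G)"
    using \<gamma> t by (intro bij_betwI[where g = "\<lambda>z. inv \<gamma> \<otimes> z \<otimes> \<gamma> \<otimes> inv t"])
      (auto simp: m_assoc mult_inv_cancel_left)
  have bij\<gamma>: "bij_betw ((\<otimes>) \<gamma>) (carrier G) (carrier G)"
    using inj_on_cmult[OF \<gamma>] surj_const_mult[OF \<gamma>] by (simp add: bij_betw_def)
  have F0: "F y \<ge> 0" if "y \<in> carrier G" for y using that f \<gamma> by (simp add: F)
  have \<phi>: "?\<phi> y \<in> carrier G" if "y \<in> carrier G" for y using that \<gamma> t by simp
  have "(\<Sum>y\<in>carrier G. \<bar>F (?\<phi> y) - F y\<bar>) \<le> (\<Sum>y\<in>carrier G. \<bar>f (\<gamma> \<otimes> y \<otimes> (t \<otimes> inv \<gamma>)) - f (\<gamma> \<otimes> y)\<bar>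
      + \<bar>f (y \<otimes> (t \<otimes> \<gamma>)) - f y\<bar>)"
  proof (rule sum_mono)
    fix y assume y: "y \<in> carrier G"
    have "\<gamma> \<otimes> ?\<phi> y = (\<gamma> \<otimes> \<gamma> \<otimes> (y \<otimes> t)) \<otimes> inv \<gamma>" using y \<gamma> t by (simp add: m_assoc)
    also have "\<dots> = y \<otimes> (t \<otimes> \<gamma>)" using y \<gamma> t by (subst central) (simp_all add: m_assoc)
    finally have 1: "\<gamma> \<otimes> ?\<phi> y = y \<otimes> (t \<otimes> \<gamma>)" .
    have 2: "?\<phi> y = \<gamma> \<otimes> y \<otimes> (t \<otimes> inv \<gamma>)" using y \<gamma> t by (simp add: m_assoc)
    show "\<bar>F (?\<phi> y) - F y\<bar> \<le> \<bar>f (\<gamma> \<otimes> y \<otimes> (t \<otimes> inv \<gamma>)) - f (\<gamma> \<otimes> y)\<bar> + \<bar>f (y \<otimes> (t \<otimes> \<gamma>)) - f y\<bar>"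
      unfolding F[of "?\<phi> y"] F[of y] 1 unfolding 2 by linarith
  qed
  also have "\<dots> = (\<Sum>y\<in>carrier G. \<bar>f (y \<otimes> (t \<otimes> inv \<gamma>)) - f y\<bar>) + (\<Sum>y\<in>carrier G. \<bar>f (y \<otimes> (t \<otimes> \<gamma>)) - f y\<bar>)"
    unfolding sum.distrib
    using sum.reindex_bij_betw[OF bij\<gamma>, of "\<lambda>y. \<bar>f (y \<otimes> (t \<otimes> inv \<gamma>)) - f y\<bar>"] by simp
  finally have diff: "(\<Sum>y\<in>carrier G. \<bar>F (?\<phi> y) - F y\<bar>) \<le> 2 * \<delta>" using d1 d2 by linarith
  \<comment> \<open>The product of square roots dominates the minimum, which turns the l1 estimate
    into a lower bound for the correlation; half of 2 \<delta> is lost.\<close>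
  have sqrt_ge: "(a + b) / 2 - \<bar>b - a\<bar> / 2 \<le> sqrt a * sqrt b" if "a \<ge> 0" "b \<ge> 0" for a b :: real
  proof -
    have "(a + b) / 2 - \<bar>b - a\<bar> / 2 = min a b" by (simp add: min_def abs_if field_simps)
    also have "\<dots> = sqrt (min a b) * sqrt (min a b)" using that by simp
    also have "\<dots> \<le> sqrt a * sqrt b" using that by (intro mult_mono) auto
    finally show ?thesis .
  qed
  have "(\<Sum>y\<in>carrier G. F y) - \<delta> \<le> ((\<Sum>y\<in>carrier G. F y) + (\<Sum>y\<in>carrier G. F (?\<phi> y))) / 2
      - (\<Sum>y\<in>carrier G. \<bar>F (?\<phi> y) - F y\<bar>) / 2"
    using diff sum.reindex_bij_betw[OF bij, of F] by simp
  also have "\<dots> = (\<Sum>y\<in>carrier G. (F y + F (?\<phi> y)) / 2 - \<bar>F (?\<phi> y) - F y\<bar> / 2)"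
    by (simp only: sum_subtractf sum_divide_distrib[symmetric] sum.distrib)
  also have "\<dots> \<le> (\<Sum>y\<in>carrier G. sqrt (F y) * sqrt (F (?\<phi> y)))"
    by (intro sum_mono sqrt_ge F0 \<phi>)
  finally show ?thesis .
qed

text \<open>The fibre count is the push-forward of \<open>F\<close> under x \<mapsto> h (x^-1); the
  inversion turns left translation by \<open>k\<close> into right translation by \<open>h k\<close>.
  The sum is at most the size of the symmetric difference of k F and F, whose halves have equal
  size, hence the factor 2.\<close>

lemma (in group_hom) fibre_count_translate:
  fixes \<epsilon> :: real
  assumes fin: "finite (carrier H)" and F: "finite F" "F \<subseteq> carrier G" and k: "k \<in> carrier G"
    and small: "card (l_coset G k F - F) \<le> \<epsilon> * card F"
  shows "(\<Sum>y\<in>carrier H. \<bar>real (card {x \<in> F. h (inv x) = y \<otimes>\<^bsub>H\<^esub> h k})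
    - real (card {x \<in> F. h (inv x) = y})\<bar>) \<le> 2 * \<epsilon> * card F"
proof -
  define cnt where "cnt A y = real (card {x \<in> A. h (inv x) = y})" for A y
  let ?kF = "l_coset G k F"
  have kF: "?kF = (\<lambda>x. k \<otimes> x) ` F" by (auto simp: l_coset_def)
  have inj: "inj_on (\<lambda>x. k \<otimes> x) F" 
    by (rule inj_on_subset[OF G.inj_on_cmult[OF k] F(2)])
  have finkF: "finite ?kF" "?kF \<subseteq> carrier G" using F k by (auto simp: kF)
  have sum_cnt: "(\<Sum>y\<in>carrier H. cnt A y) = card A" if "finite A" "A \<subseteq> carrier G" for A
  proof -
    have "(\<lambda>x. h (inv x)) ` A \<subseteq> carrier H" using that(2) by auto
    from sum.group[OF that(1) fin this, of "\<lambda>_. 1 :: nat"]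
    have "(\<Sum>y\<in>carrier H. card {x \<in> A. h (inv x) = y}) = card A" by simp
    then show ?thesis unfolding cnt_def by (metis of_nat_sum)
  qed
  have diff: "\<bar>cnt A y - cnt B y\<bar> \<le> cnt (A - B) y + cnt (B - A) y" if "finite A" "finite B" for A B y
  proof -
    have le: "cnt A y \<le> cnt B y + cnt (A - B) y" if "finite A" "finite B" for A B
    proof -
      have "card {x \<in> A. h (inv x) = y} \<le> card ({x \<in> B. h (inv x) = y} \<union> {x \<in> A - B. h (inv x) = y})"
        using that by (intro card_mono) auto
      also have "\<dots> \<le> card {x \<in> B. h (inv x) = y} + card {x \<in> A - B. h (inv x) = y}"
        by (rule card_Un_le)
      finally show ?thesis by (simp add: cnt_def)
    qed
    show ?thesis using le[of A B] le[of B A] that by (simp add: cnt_def)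
  qed
  have shift: "cnt F (y \<otimes>\<^bsub>H\<^esub> h k) = cnt ?kF y" if y: "y \<in> carrier H" for y
  proof -
    have "h (inv (k \<otimes> x)) = y \<longleftrightarrow> h (inv x) = y \<otimes>\<^bsub>H\<^esub> h k" if "x \<in> F" for x
    proof -
      have "x \<in> carrier G" using that F by auto
      then have "h (inv (k \<otimes> x)) = h (inv x) \<otimes>\<^bsub>H\<^esub> inv\<^bsub>H\<^esub> (h k)"
        using k by (simp add: G.inv_mult_group)
      then show ?thesis using y k \<open>x \<in> carrier G\<close> by (metis H.inv_solve_right' G.inv_closed hom_closed)
    qed
    then have "{x \<in> ?kF. h (inv x) = y} = (\<lambda>x. k \<otimes> x) ` {x \<in> F. h (inv x) = y \<otimes>\<^bsub>H\<^esub> h k}"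
      by (auto simp: kF)
    moreover have "inj_on (\<lambda>x. k \<otimes> x) {x \<in> F. h (inv x) = y \<otimes>\<^bsub>H\<^esub> h k}"
      by (rule inj_on_subset[OF inj]) auto
    ultimately show ?thesis by (simp add: cnt_def card_image)
  qed
  have "(\<Sum>y\<in>carrier H. \<bar>cnt F (y \<otimes>\<^bsub>H\<^esub> h k) - cnt F y\<bar>)
      \<le> (\<Sum>y\<in>carrier H. cnt (?kF - F) y + cnt (F - ?kF) y)"
    using F finkF by (intro sum_mono) (auto simp: shift intro: diff)
  also have "\<dots> = card (?kF - F) + card (F - ?kF)"
    using F finkF by (simp add: sum.distrib sum_cnt Diff_subset_conv le_supI2)
  also have "card (F - ?kF) = card (?kF - F)"
    using F finkF card_image[OF inj] by (simp add: card_Diff_subset_Int Int_commute flip: kF)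
  finally show ?thesis using small by (simp add: cnt_def)
qed

section \<open>Contradiction between a spectral gap and a Foelner set\<close>

theorem theorem6p2:
  fixes G :: "('a, 'm) monoid_scheme"
    and Gi :: "nat \<Rightarrow> ('b, 'n) monoid_scheme"
    and \<pi> :: "nat \<Rightarrow> 'a \<Rightarrow> 'b"
    and \<Sigma> :: "'a set"
    and g :: 'a
  assumes grp: "group G"
    and amen: "amenable G"
    and Sigma_fin: "finite \<Sigma>"
    and Sigma_sub: "\<Sigma> \<subseteq> carrier G"
    and Sigma_gen: "generate G \<Sigma> = carrier G"
    and g_in: "g \<in> carrier G"
    and sigma_invol: "\<forall>x \<in> carrier G.
          g \<otimes>\<^bsub>G\<^esub> (g \<otimes>\<^bsub>G\<^esub> x \<otimes>\<^bsub>G\<^esub> inv\<^bsub>G\<^esub> g) \<otimes>\<^bsub>G\<^esub> inv\<^bsub>G\<^esub> g = x"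
    and sigma_nontriv: "\<exists>x \<in> carrier G. g \<otimes>\<^bsub>G\<^esub> x \<otimes>\<^bsub>G\<^esub> inv\<^bsub>G\<^esub> g \<noteq> x"
    and Gi_grp: "\<forall>i. group (Gi i)"
    and Gi_fin: "\<forall>i. finite (carrier (Gi i))"
    and pi_hom: "\<forall>i. \<pi> i \<in> hom G (Gi i)"
    and pi_surj: "\<forall>i. \<pi> i ` carrier G = carrier (Gi i)"
    and kernels_distinct: "\<forall>i j. i \<noteq> j \<longrightarrow> kernel G (Gi i) (\<pi> i) \<noteq> kernel G (Gi j) (\<pi> j)"
  shows "\<not> (\<exists>c > 0. \<forall>i. \<forall>z \<in># nontrivial_spectrum_on (carrier (Gi i))
              (twisted_cayley_norm_adj (Gi i)
                 (image_mset (\<pi> i) (mset_set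
                    (\<Sigma> \<union> (\<lambda>x. g \<otimes>\<^bsub>G\<^esub> x \<otimes>\<^bsub>G\<^esub> inv\<^bsub>G\<^esub> g) ` ((\<lambda>x. inv\<^bsub>G\<^esub> x) ` \<Sigma>))))
                 (\<lambda>y. \<pi> i g \<otimes>\<^bsub>Gi i\<^esub> y \<otimes>\<^bsub>Gi i\<^esub> inv\<^bsub>Gi i\<^esub> (\<pi> i g))).
            Re z \<le> 1 - c)"
proof
  interpret group G by (rule grp)
  let ?\<sigma> = "\<lambda>x. g \<otimes>\<^bsub>G\<^esub> x \<otimes>\<^bsub>G\<^esub> inv\<^bsub>G\<^esub> g"
  define S where "S = \<Sigma> \<union> ?\<sigma> ` ((\<lambda>x. inv\<^bsub>G\<^esub> x) ` \<Sigma>)"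
  assume "\<exists>c > 0. \<forall>i. \<forall>z \<in># nontrivial_spectrum_on (carrier (Gi i))
      (twisted_cayley_norm_adj (Gi i) (image_mset (\<pi> i) (mset_set (\<Sigma> \<union> ?\<sigma> ` ((\<lambda>x. inv\<^bsub>G\<^esub> x) ` \<Sigma>))))
         (\<lambda>y. \<pi> i g \<otimes>\<^bsub>Gi i\<^esub> y \<otimes>\<^bsub>Gi i\<^esub> inv\<^bsub>Gi i\<^esub> (\<pi> i g))). Re z \<le> 1 - c"
  then obtain c where c: "c > 0" and gap: "\<And>i z. z \<in># nontrivial_spectrum_on (carrier (Gi i))
      (twisted_cayley_norm_adj (Gi i) (image_mset (\<pi> i) (mset_set S))
         (\<lambda>y. \<pi> i g \<otimes>\<^bsub>Gi i\<^esub> y \<otimes>\<^bsub>Gi i\<^esub> inv\<^bsub>Gi i\<^esub> (\<pi> i g))) \<Longrightarrow> Re z \<le> 1 - c"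
    unfolding S_def by blast
  have S: "finite S" "S \<subseteq> carrier G" using Sigma_fin Sigma_sub g_in by (auto simp: S_def)
  \<comment> \<open>An empty generating set would make the group trivial, where conjugation moves
    nothing. So \<open>card S\<close> is positive and can be divided by.\<close>
  have "\<Sigma> \<noteq> {}"
  proof
    assume "\<Sigma> = {}"
    then have "carrier G = {\<one>\<^bsub>G\<^esub>}" using Sigma_gen generate_empty by simp
    then show False using sigma_nontriv g_in by auto
  qed
  then have card_S: "card S > 0" using S(1) by (auto simp: card_gt_0_iff S_def)
  have gg: "(g \<otimes>\<^bsub>G\<^esub> g) \<otimes>\<^bsub>G\<^esub> x = x \<otimes>\<^bsub>G\<^esub> (g \<otimes>\<^bsub>G\<^esub> g)" if "x \<in> carrier G" for x
  proof -
    have "x \<otimes>\<^bsub>G\<^esub> (g \<otimes>\<^bsub>G\<^esub> g) = g \<otimes>\<^bsub>G\<^esub> ?\<sigma> x \<otimes>\<^bsub>G\<^esub> inv\<^bsub>G\<^esub> g \<otimes>\<^bsub>G\<^esub> (g \<otimes>\<^bsub>G\<^esub> g)"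
      using sigma_invol that by simp
    also have "\<dots> = (g \<otimes>\<^bsub>G\<^esub> g) \<otimes>\<^bsub>G\<^esub> x"
      using that g_in by (simp add: m_assoc mult_inv_cancel_left)
    finally show ?thesis ..
  qed
  \<comment> \<open>\<open>rev t\<close> labels the reverse of an edge labelled \<open>t\<close>. It
    is an involution on \<open>S\<close>, which makes the operator symmetric.\<close>
  define rev where "rev t = ?\<sigma> (inv\<^bsub>G\<^esub> t)" for t
  have rev_rev: "rev (rev t) = t" if "t \<in> carrier G" for t
    using sigma_invol that g_in by (simp add: rev_def inv_mult_group m_assoc)
  have rev_S: "rev t \<in> S" if tS: "t \<in> S" for t
  proof (cases "t \<in> \<Sigma>")
    case False
    then obtain s where s: "s \<in> \<Sigma>" "t = rev s" using tS by (auto simp: S_def rev_def)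
    then have "rev t = s" using rev_rev Sigma_sub by blast
    then show ?thesis using s by (simp add: S_def)
  qed (auto simp: S_def rev_def)
  \<comment> \<open>The images of these elements are the right translations required by
    \<open>sqrt_correlation_ge\<close>. The tolerance c / 4 chosen below is doubled by
    \<open>fibre_count_translate\<close>, so that \<delta> becomes c / 2 times
    \<open>card F\<close>.\<close>
  let ?K = "(\<lambda>t. t \<otimes>\<^bsub>G\<^esub> inv\<^bsub>G\<^esub> g) ` S \<union> (\<lambda>t. t \<otimes>\<^bsub>G\<^esub> g) ` S"
  have K: "finite ?K" "?K \<subseteq> carrier G" using S g_in by auto
  obtain F where F: "finite F" "F \<noteq> {}" "F \<subseteq> carrier G"
    and foelner: "\<And>k. k \<in> ?K \<Longrightarrow> card (l_coset G k F - F) \<le> c / 4 * card F"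
    using amenable_foelner[OF amen K, of "c / 4"] c by auto
  \<comment> \<open>The factor 4 makes the term from the constants, at most c (2 card F)^2 / card
    (carrier (Gi i)), no larger than c card F.\<close>
  obtain i where i: "4 * card F < card (carrier (Gi i))"
    using exists_large_quotient[where Gi = Gi and \<pi> = \<pi> and N = "4 * card F", OF Sigma_fin Sigma_sub Sigma_gen]
      Gi_grp Gi_fin pi_hom kernels_distinct by auto
  define H where "H = Gi i"
  define p where "p = \<pi> i"
  define \<gamma> where "\<gamma> = p g"
  interpret gh: group_hom G H p
    using Gi_grp pi_hom grp by (simp add: group_hom_def group_hom_axioms_def H_def p_def)
  have fin: "finite (carrier H)" using Gi_fin by (simp add: H_def)
  have surj: "\<exists>x\<in>carrier G. p x = y" if "y \<in> carrier H" for y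
    using pi_surj that unfolding H_def p_def by (metis imageE)
  have \<gamma>: "\<gamma> \<in> carrier H" using g_in by (simp add: \<gamma>_def)
  have central: "\<gamma> \<otimes>\<^bsub>H\<^esub> \<gamma> \<otimes>\<^bsub>H\<^esub> y = y \<otimes>\<^bsub>H\<^esub> (\<gamma> \<otimes>\<^bsub>H\<^esub> \<gamma>)" if "y \<in> carrier H" for y
  proof -
    obtain x where x: "x \<in> carrier G" "p x = y" using surj \<open>y \<in> carrier H\<close> by blast
    show ?thesis using arg_cong[OF gg[OF x(1)], of p] x g_in by (simp add: \<gamma>_def)
  qed
  define \<phi> where "\<phi> t y = \<gamma> \<otimes>\<^bsub>H\<^esub> (y \<otimes>\<^bsub>H\<^esub> p t) \<otimes>\<^bsub>H\<^esub> inv\<^bsub>H\<^esub> \<gamma>" for t y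
  have \<phi>: "\<phi> t y \<in> carrier H" if "t \<in> S" "y \<in> carrier H" for t y
    using that S(2) \<gamma> by (auto simp: \<phi>_def)
  \<comment> \<open>This is checked on a preimage x in \<open>G\<close>, where \<sigma> is an
    involution: \<sigma>(x t) \<sigma>(t^-1) = \<sigma>(x), and a second \<sigma> returns x.\<close>
  have \<phi>_rev: "\<phi> (rev t) (\<phi> t y) = y" if t: "t \<in> S" and y: "y \<in> carrier H" for t y
  proof -
    have tG: "t \<in> carrier G" using t S(2) by blast
    obtain x where x: "x \<in> carrier G" "p x = y" using surj y by blast
    have "\<phi> (rev t) (\<phi> t y) = p (?\<sigma> (?\<sigma> (x \<otimes>\<^bsub>G\<^esub> t) \<otimes>\<^bsub>G\<^esub> rev t))"
      using x tG g_in by (simp add: \<phi>_def \<gamma>_def rev_def)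
    also have "?\<sigma> (x \<otimes>\<^bsub>G\<^esub> t) \<otimes>\<^bsub>G\<^esub> rev t = ?\<sigma> x"
      using x tG g_in by (simp add: rev_def m_assoc mult_inv_cancel_left)
    also have "?\<sigma> (?\<sigma> x) = x" using sigma_invol x by simp
    finally show ?thesis using x by simp
  qed
  \<comment> \<open>Counting labels in \<open>S\<close> rather than their images keeps the
    multiplicities of the image multiset.\<close>
  define m where "m x y = real (card {t \<in> S. \<phi> t x = y}) / card S" for x y
  have adj: "twisted_cayley_norm_adj (Gi i) (image_mset (\<pi> i) (mset_set S))
       (\<lambda>y. \<pi> i g \<otimes>\<^bsub>Gi i\<^esub> y \<otimes>\<^bsub>Gi i\<^esub> inv\<^bsub>Gi i\<^esub> (\<pi> i g)) = (\<lambda>x y. complex_of_real (m x y))"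
    using S(1) by (intro ext) (simp add: twisted_cayley_norm_adj_def m_def \<phi>_def H_def p_def \<gamma>_def
        filter_mset_image_mset)
  have sym: "m x y = m y x" if "x \<in> carrier H" "y \<in> carrier H" for x y
  proof -
    have "bij_betw rev {t \<in> S. \<phi> t x = y} {t \<in> S. \<phi> t y = x}"
      using that rev_S rev_rev \<phi>_rev S(2) by (intro bij_betwI[where g = rev]) blast+
    then show ?thesis by (simp add: m_def bij_betw_same_card)
  qed
  have sum_m: "(\<Sum>y\<in>carrier H. m x y * b y) = (\<Sum>t\<in>S. b (\<phi> t x)) / card S"
    if x: "x \<in> carrier H" for x b
  proof -
    have "(\<Sum>t\<in>S. b (\<phi> t x)) = (\<Sum>y\<in>carrier H. \<Sum>t\<in>{t \<in> S. \<phi> t x = y}. b (\<phi> t x))"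
      using \<phi>[OF _ x] by (intro sum.group[OF S(1) fin, symmetric]) auto
    also have "\<dots> = (\<Sum>y\<in>carrier H. real (card {t \<in> S. \<phi> t x = y}) * b y)"
      by (intro sum.cong refl) simp
    finally show ?thesis by (simp add: m_def sum_divide_distrib)
  qed
  have row: "(\<Sum>y\<in>carrier H. m x y) = 1" if "x \<in> carrier H" for x
    using sum_m[OF that, of "\<lambda>_. 1"] card_S by simp
  \<comment> \<open>\<open>f\<close> is the push-forward of the Foelner set and \<open>F2\<close>
    its symmetrization under \<gamma>; the square root \<open>b\<close> has squared norm equal to
    the mass 2 card F of \<open>F2\<close>.\<close>
  define f where "f y = real (card {x \<in> F. p (inv\<^bsub>G\<^esub> x) = y})" for y
  define F2 where "F2 y = f y + f (\<gamma> \<otimes>\<^bsub>H\<^esub> y)" for y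
  define b where "b y = sqrt (F2 y)" for y
  have sum_f: "(\<Sum>y\<in>carrier H. f y) = card F"
  proof -
    have "(\<lambda>x. p (inv\<^bsub>G\<^esub> x)) ` F \<subseteq> carrier H" using F(3) by auto
    from sum.group[OF F(1) fin this, of "\<lambda>_. 1 :: nat"]
    have "(\<Sum>y\<in>carrier H. card {x \<in> F. p (inv\<^bsub>G\<^esub> x) = y}) = card F" by simp
    then show ?thesis unfolding f_def by (metis of_nat_sum)
  qed
  have "bij_betw ((\<otimes>\<^bsub>H\<^esub>) \<gamma>) (carrier H) (carrier H)"
    using gh.H.inj_on_cmult[OF \<gamma>] gh.H.surj_const_mult[OF \<gamma>] by (simp add: bij_betw_def)
  from sum.reindex_bij_betw[OF this, of f] have sum_F2: "(\<Sum>y\<in>carrier H. F2 y) = 2 * card F"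
    by (simp add: F2_def sum.distrib sum_f)
  have F2_nonneg: "F2 y \<ge> 0" for y by (simp add: F2_def f_def)
  have corr: "2 * card F - c / 2 * card F \<le> (\<Sum>y\<in>carrier H. b y * b (\<phi> t y))" if t: "t \<in> S" for t
  proof -
    have tG: "t \<in> carrier G" using t S(2) by blast
    have "(\<Sum>y\<in>carrier H. \<bar>f (y \<otimes>\<^bsub>H\<^esub> p k) - f y\<bar>) \<le> 2 * (c / 4) * card F" if "k \<in> ?K" for k
      using gh.fibre_count_translate[OF fin F(1,3) _ foelner[OF that]] that K(2) unfolding f_def by blast
    from this[of "t \<otimes>\<^bsub>G\<^esub> inv\<^bsub>G\<^esub> g"] this[of "t \<otimes>\<^bsub>G\<^esub> g"]
    have "(\<Sum>y\<in>carrier H. \<bar>f (y \<otimes>\<^bsub>H\<^esub> (p t \<otimes>\<^bsub>H\<^esub> inv\<^bsub>H\<^esub> \<gamma>)) - f y\<bar>) \<le> c / 2 * card F"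
      "(\<Sum>y\<in>carrier H. \<bar>f (y \<otimes>\<^bsub>H\<^esub> (p t \<otimes>\<^bsub>H\<^esub> \<gamma>)) - f y\<bar>) \<le> c / 2 * card F"
      using t tG g_in by (simp_all add: \<gamma>_def)
    then have "(\<Sum>y\<in>carrier H. F2 y) - c / 2 * card F
      \<le> (\<Sum>y\<in>carrier H. sqrt (F2 y) * sqrt (F2 (\<gamma> \<otimes>\<^bsub>H\<^esub> (y \<otimes>\<^bsub>H\<^esub> p t) \<otimes>\<^bsub>H\<^esub> inv\<^bsub>H\<^esub> \<gamma>)))"
      using tG by (intro gh.H.sqrt_correlation_ge[where f = f] fin \<gamma> central) (simp_all add: F2_def f_def)
    then show ?thesis by (simp add: sum_F2 b_def \<phi>_def)
  qed
  have form: "2 * card F - c / 2 * card F \<le> (\<Sum>x\<in>carrier H. \<Sum>y\<in>carrier H. m x y * b x * b y)"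
  proof -
    have "card S * (2 * card F - c / 2 * card F) \<le> (\<Sum>t\<in>S. \<Sum>x\<in>carrier H. b x * b (\<phi> t x))"
      using sum_mono[OF corr, of S "\<lambda>t. t"] by simp
    also have "\<dots> = (\<Sum>x\<in>carrier H. b x * (\<Sum>t\<in>S. b (\<phi> t x)))"
      by (subst sum.swap) (simp add: sum_distrib_left)
    also have "\<dots> = (\<Sum>x\<in>carrier H. b x * (card S * (\<Sum>y\<in>carrier H. m x y * b y)))"
      using card_S by (intro sum.cong refl) (simp add: sum_m)
    also have "\<dots> = card S * (\<Sum>x\<in>carrier H. \<Sum>y\<in>carrier H. m x y * b x * b y)"
      by (simp add: sum_distrib_left mult_ac)
    finally show ?thesis using card_S by simp
  qed
  \<comment> \<open>\<open>F2\<close> takes natural values, so its square root \<open>b\<close> is at most \<open>F2\<close>.\<close>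
  have sum_b: "(\<Sum>y\<in>carrier H. b y) \<le> 2 * card F"
  proof -
    have "b y \<le> F2 y" for y
    proof -
      obtain k :: nat where k: "F2 y = real k" unfolding F2_def f_def by (metis of_nat_add)
      have "real k \<le> real (k\<^sup>2)" by (simp only: of_nat_le_iff) (simp add: power2_eq_square)
      then show ?thesis by (simp add: b_def k real_le_lsqrt)
    qed
    then show ?thesis using sum_mono[of "carrier H" b F2] sum_F2 by simp
  qed
  have b_sq: "(\<Sum>x\<in>carrier H. (b x)\<^sup>2) = 2 * card F"
    using sum_F2 F2_nonneg by (simp add: b_def)
  define k where "k = real (card F)"
  define N where "N = real (card (carrier H))"
  have k: "k > 0" using F by (simp add: k_def card_gt_0_iff)
  have N: "4 * k \<le> N" using i by (simp add: k_def N_def H_def)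
  have "(\<Sum>x\<in>carrier H. \<Sum>y\<in>carrier H. m x y * b x * b y)
      \<le> (1 - c) * (\<Sum>x\<in>carrier H. (b x)\<^sup>2) + c * (\<Sum>x\<in>carrier H. b x)\<^sup>2 / N"
    unfolding N_def
  proof (rule nontrivial_quadratic_form_bound[OF fin _ sym row])
    show "carrier H \<noteq> {}" using gh.H.one_closed by blast
    show "Re z \<le> 1 - c"
      if "z \<in># nontrivial_spectrum_on (carrier H) (\<lambda>x y. complex_of_real (m x y))" for z
      using that by (rule gap[of _ i, unfolded adj, folded H_def])
  qed
  then have upper: "2 * k - c / 2 * k \<le> (1 - c) * (2 * k) + c * (\<Sum>x\<in>carrier H. b x)\<^sup>2 / N"
    using form b_sq by (simp add: k_def)
  have "(\<Sum>x\<in>carrier H. b x)\<^sup>2 \<le> (2 * k)\<^sup>2"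
    using sum_b F2_nonneg by (intro power_mono sum_nonneg) (simp_all add: b_def k_def)
  also have "\<dots> = 4 * k * k" by (simp add: power2_eq_square)
  also have "\<dots> \<le> N * k" using N k by (intro mult_right_mono) simp_all
  finally have "c * (\<Sum>x\<in>carrier H. b x)\<^sup>2 \<le> c * (N * k)"
    using c by (intro mult_left_mono) simp_all
  then have "c * (\<Sum>x\<in>carrier H. b x)\<^sup>2 / N \<le> c * k"
    using N k by (subst pos_divide_le_eq) (linarith, simp only: mult.assoc mult.commute[of k N])
  \<comment> \<open>The left side is 2 k - c k / 2 and the right side 2 k - c k, which is
    smaller.\<close>
  with upper have "2 * k - c / 2 * k \<le> (1 - c) * (2 * k) + c * k" by linarith
  moreover have "c * k > 0" using c k by simp
  ultimately show False by (simp add: algebra_simps)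
qed

end
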